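(* For each $m\in\mathbb{N}$ there exists $N'_m\in\mathbb{N}$ such that if $n\ge N'_m$ then the graph $\mathcal{O}(\mathrm{A}_n)$, where $\mathrm{A}_n$ is the alternating group of degree $n$, has at least $m$ connected components containing Hurwitz maps.
   Context: An orientably regular map $\mathcal{M}$ with orientation-preserving automorphism group $\mathrm{Aut}^+\mathcal{M}\cong G$ ($G$ a finite group) is equivalent to a generating triple $(x,y,z)$ of $G$ with $y$ of order $2$ and $xyz=1$; here $x$ rotates arcs (directed edges) around their incident vertices following the orientation, $y$ reverses arcs, and $z$ rotates arcs around faces. Two maps are isomorphic if and only if their triples are equivalent under $\mathrm{Aut}\,G$. $\mathcal{O}(G)$ denotes the set of isomorphism classes of orientably regular maps $\mathcal{M}$ with $\mathrm{Aut}^+\mathcal{M}\cong G$. If $z$ has order $k$ and $x$ has order $l$, the map has type $\{k,l\}$ (faces are $k$-gons, vertices have valency $l$). A Hurwitz map is an orientably regular map of type $\{3,7\}$ with finite orientation-preserving automorphism group (i.e. $x$ has order $7$, $y$ has order $2$, $z$ has order $3$). Duality $D$ replaces $(x,y,z)$ by $(z,y,(zy)^{-1})$. For $j$ coprime to the valency $l$, the hole operation $H_j$ replaces $(x,y,z)$ by $(x^j,y,(x^jy)^{-1})$. Both operations preserve $G$, so they act on maps in $\mathcal{O}(G)$. The set $\mathcal{O}(G)$ is regarded as the vertex set of a graph, also denoted $\mathcal{O}(G)$, in which each $\mathcal{M}$ is joined by edges to $D(\mathcal{M})$ and to $H_j(\mathcal{M})$ for all $j$ coprime to the valency of $\mathcal{M}$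 (loops omitted; connectedness ignores edge directions). *)

theory Defs
  imports "HOL-Algebra.Algebra"
begin

section \<open>Orientably regular maps as generating triples\<close>

text \<open>
  An orientably regular map with orientation-preserving automorphism group \<open>G\<close> is a generating
  triple \<open>(x, y, z)\<close> of \<open>G\<close> with \<open>y\<close> of order 2 and \<open>xyz = 1\<close>; isomorphism of maps is
  equivalence of triples under \<open>Aut G\<close>.  An isomorphism class is hence an \<open>Aut G\<close>-orbit of triples.
\<close>

type_synonym 'a triple = "'a \<times> 'a \<times> 'a"

definition map_triples :: "('a, 'b) monoid_scheme \<Rightarrow> 'a triple set" where
  "map_triples G = {(x, y, z). x \<in> carrier G \<and> y \<in> carrier G \<and> z \<in> carrier G
     \<and> generate G {x, y, z} = carrier G
     \<and> group.ord G y = 2 \<and> x \<otimes>\<^bsub>G\<^esub> y \<otimes>\<^bsub>G\<^esub> z = \<one>\<^bsub>G\<^esub>}"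

fun apply_triple :: "('a \<Rightarrow> 'a) \<Rightarrow> 'a triple \<Rightarrow> 'a triple" where
  "apply_triple \<phi> (x, y, z) = (\<phi> x, \<phi> y, \<phi> z)"

definition triple_equiv :: "('a, 'b) monoid_scheme \<Rightarrow> ('a triple \<times> 'a triple) set" where
  "triple_equiv G = {(s, t). s \<in> map_triples G \<and> t \<in> map_triples G
     \<and> (\<exists>\<phi> \<in> auto G. t = apply_triple \<phi> s)}"

definition regular_maps :: "('a, 'b) monoid_scheme \<Rightarrow> 'a triple set set" where
  "regular_maps G = map_triples G // triple_equiv G"

text \<open>
  Type \<open>{k, l}\<close>: faces are \<open>k\<close>-gons, vertices have valency \<open>l\<close>.  The orders are constant on
  an isomorphism class, so it is immaterial that all representatives are considered.
\<close>

definition has_type :: "('a, 'b) monoid_scheme \<Rightarrow> 'a triple set \<Rightarrow> nat \<Rightarrow> nat \<Rightarrow> bool" where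
  "has_type G M k l \<longleftrightarrow> (\<forall>(x, y, z) \<in> M. group.ord G z = k \<and> group.ord G x = l)"

definition hurwitz_map :: "('a, 'b) monoid_scheme \<Rightarrow> 'a triple set \<Rightarrow> bool" where
  "hurwitz_map G M \<longleftrightarrow> finite (carrier G) \<and> M \<in> regular_maps G \<and> has_type G M 3 7"


section \<open>Duality and hole operations\<close>

fun dual_triple :: "('a, 'b) monoid_scheme \<Rightarrow> 'a triple \<Rightarrow> 'a triple" where
  "dual_triple G (x, y, z) = (z, y, inv\<^bsub>G\<^esub> (z \<otimes>\<^bsub>G\<^esub> y))"

fun hole_triple :: "('a, 'b) monoid_scheme \<Rightarrow> int \<Rightarrow> 'a triple \<Rightarrow> 'a triple" where
  "hole_triple G j (x, y, z) =
     (x [^]\<^bsub>G\<^esub> j, y, inv\<^bsub>G\<^esub> ((x [^]\<^bsub>G\<^esub> j) \<otimes>\<^bsub>G\<^esub> y))"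

text \<open>
  Both operations commute with \<open>Aut G\<close>, so they act on isomorphism classes by taking images; see
  \<open>dual_map_in_regular_maps\<close> and \<open>hole_map_in_regular_maps\<close> below.
\<close>

definition dual_map :: "('a, 'b) monoid_scheme \<Rightarrow> 'a triple set \<Rightarrow> 'a triple set" where
  "dual_map G M = dual_triple G ` M"

definition hole_map :: "('a, 'b) monoid_scheme \<Rightarrow> int \<Rightarrow> 'a triple set \<Rightarrow> 'a triple set" where
  "hole_map G j M = hole_triple G j ` M"


section \<open>The graph on the isomorphism classes and its components\<close>

definition map_edges :: "('a, 'b) monoid_scheme \<Rightarrow> ('a triple set \<times> 'a triple set) set" where
  "map_edges G = {(M, N). M \<in> regular_maps G \<and> N \<in> regular_maps G \<and> M \<noteq> N
     \<and> (N = dual_map G M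
        \<or> (\<exists>k l j. has_type G M k l \<and> coprime j (int l) \<and> N = hole_map G j M))}"

definition map_connected :: "('a, 'b) monoid_scheme \<Rightarrow> ('a triple set \<times> 'a triple set) set" where
  "map_connected G = {(M, N). M \<in> regular_maps G \<and> N \<in> regular_maps G
     \<and> (M, N) \<in> (map_edges G \<union> (map_edges G)\<inverse>)\<^sup>*}"

definition map_components :: "('a, 'b) monoid_scheme \<Rightarrow> 'a triple set set set" where
  "map_components G = regular_maps G // map_connected G"


section \<open>Well-definedness\<close>

lemma equiv_map_connected: "equiv (regular_maps G) (map_connected G)"
proof (rule equivI)
  have "sym ((map_edges G \<union> (map_edges G)\<inverse>)\<^sup>*)"
    by (rule sym_rtrancl) (auto simp: sym_def)
  then show "sym (map_connected G)"
    by (auto simp: map_connected_def sym_def)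
qed (auto simp: map_connected_def refl_on_def trans_def)

context group
begin

lemma autoD:
  assumes "\<phi> \<in> auto G"
  shows "group_hom G G \<phi>" "bij_betw \<phi> (carrier G) (carrier G)"
  using assms by (auto simp: auto_def Bij_def group_hom_def group_hom_axioms_def)

lemma ord_auto:
  assumes "\<phi> \<in> auto G" "x \<in> carrier G"
  shows "ord (\<phi> x) = ord x"
proof -
  interpret group_hom G G \<phi> by (rule autoD[OF assms(1)])
  have inj: "inj_on \<phi> (carrier G)" using autoD(2)[OF assms(1)] by (rule bij_betw_imp_inj_on)
  have "\<phi> x [^] n = \<one> \<longleftrightarrow> x [^] n = \<one>" for n :: nat
    using assms(2) inj by (metis hom_nat_pow hom_one inj_onD nat_pow_closed one_closed)
  then show ?thesis
    using assms(2) by (metis dvd_antisym dvd_refl hom_closed pow_eq_id)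
qed

lemma apply_triple_in_map_triples:
  assumes "\<phi> \<in> auto G" "t \<in> map_triples G"
  shows "apply_triple \<phi> t \<in> map_triples G"
proof -
  interpret group_hom G G \<phi> by (rule autoD[OF assms(1)])
  obtain x y z where t: "t = (x, y, z)" by (cases t)
  have c: "x \<in> carrier G" "y \<in> carrier G" "z \<in> carrier G" 
    and gen: "generate G {x, y, z} = carrier G" and o: "ord y = 2" and e: "x \<otimes> y \<otimes> z = \<one>"
    using assms(2) by (auto simp: t map_triples_def)
  have "generate G (\<phi> ` {x, y, z}) = \<phi> ` carrier G"
    using generate_img[of "{x, y, z}"] c gen by simp
  then have "generate G {\<phi> x, \<phi> y, \<phi> z} = carrier G"
    using autoD(2)[OF assms(1)] by (simp add: bij_betw_def)
  moreover have "\<phi> x \<otimes> \<phi> y \<otimes> \<phi> z = \<one>"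
    using c e by (metis hom_mult hom_one m_closed)
  ultimately show ?thesis
    using c o ord_auto[OF assms(1) c(2)] by (simp add: t map_triples_def)
qed

lemma equiv_triple_equiv: "equiv (map_triples G) (triple_equiv G)"
proof (rule equivI)
  let ?A = "AutoGroup G"
  interpret A: group ?A by (rule AutoGroup)
  have carr: "carrier ?A = auto G" by (simp add: AutoGroup_def)
  show "triple_equiv G \<subseteq> map_triples G \<times> map_triples G"
    by (auto simp: triple_equiv_def)
  show "refl_on (map_triples G) (triple_equiv G)"
  proof (rule refl_onI)
    fix t assume t: "t \<in> map_triples G"
    then have "t = apply_triple (\<lambda>x \<in> carrier G. x) t"
      by (auto simp: map_triples_def)
    then show "(t, t) \<in> triple_equiv G"
      unfolding triple_equiv_def using t id_in_auto by blast
  qed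
  show "sym (triple_equiv G)"
  proof (rule symI)
    fix s t assume "(s, t) \<in> triple_equiv G"
    then obtain \<phi> where st: "s \<in> map_triples G" "t \<in> map_triples G"
      and \<phi>: "\<phi> \<in> auto G" "t = apply_triple \<phi> s"
      by (auto simp: triple_equiv_def)
    have b: "bij_betw \<phi> (carrier G) (carrier G)" using \<phi>(1) by (rule autoD)
    let ?\<psi> = "\<lambda>x \<in> carrier G. inv_into (carrier G) \<phi> x"
    have "\<phi> \<in> Bij (carrier G)" using \<phi>(1) by (simp add: auto_def)
    then have "?\<psi> \<in> auto G"
      using \<phi>(1) by (auto simp: auto_def restrict_inv_into_Bij intro: restrict_inv_into_hom)
    moreover have "s = apply_triple ?\<psi> t"
      using st b \<phi>(2)
      by (auto simp: map_triples_def bij_betw_def)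
    ultimately show "(t, s) \<in> triple_equiv G"
      unfolding triple_equiv_def using st by blast
  qed
  show "trans (triple_equiv G)"
  proof (rule transI)
    fix s t u assume "(s, t) \<in> triple_equiv G" "(t, u) \<in> triple_equiv G"
    then obtain \<phi> \<psi> where st: "s \<in> map_triples G" "u \<in> map_triples G"
      and \<phi>: "\<phi> \<in> auto G" "t = apply_triple \<phi> s"
      and \<psi>: "\<psi> \<in> auto G" "u = apply_triple \<psi> t"
      by (auto simp: triple_equiv_def)
    have "compose (carrier G) \<psi> \<phi> \<in> auto G"
      using A.m_closed[of \<psi> \<phi>] \<phi>(1) \<psi>(1)
      by (simp add: carr) (simp add: AutoGroup_def BijGroup_def auto_def)
    moreover have "u = apply_triple (compose (carrier G) \<psi> \<phi>) s"
      using st(1) \<phi>(2) \<psi>(2) by (auto simp: map_triples_def compose_def)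
    ultimately show "(s, u) \<in> triple_equiv G"
      unfolding triple_equiv_def using st by blast
  qed
qed

lemma triple_equiv_class:
  assumes "t \<in> map_triples G"
  shows "triple_equiv G `` {t} = (\<lambda>\<phi>. apply_triple \<phi> t) ` auto G"
  using assms apply_triple_in_map_triples[OF _ assms]
  unfolding triple_equiv_def Image_singleton image_def mem_Collect_eq case_prod_conv by blast

lemma regular_map_rep:
  assumes "M \<in> regular_maps G"
  obtains t where "t \<in> map_triples G" "M = (\<lambda>\<phi>. apply_triple \<phi> t) ` auto G"
proof -
  obtain t where t: "t \<in> map_triples G" "M = triple_equiv G `` {t}"
    using assms by (auto simp: regular_maps_def elim: quotientE)
  then show ?thesis using that triple_equiv_class by simp
qed

lemma orbit_in_regular_maps:
  assumes "t \<in> map_triples G"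
  shows "(\<lambda>\<phi>. apply_triple \<phi> t) ` auto G \<in> regular_maps G"
  using assms by (metis quotientI regular_maps_def triple_equiv_class)

lemma regular_map_has_type:
  assumes "M \<in> regular_maps G"
  shows "\<exists>!(k, l). has_type G M k l"
proof -
  obtain t where t: "t \<in> map_triples G" "M = (\<lambda>\<phi>. apply_triple \<phi> t) ` auto G"
    using assms by (rule regular_map_rep)
  obtain x y z where xyz: "t = (x, y, z)" by (cases t)
  have c: "x \<in> carrier G" "z \<in> carrier G" using t(1) by (auto simp: xyz map_triples_def)
  have "has_type G M k l \<longleftrightarrow> k = ord z \<and> l = ord x" for k l
    using c ord_auto id_in_auto by (auto simp: has_type_def t(2) xyz)
  then show ?thesis by auto
qed

lemma dual_triple_in_map_triples:
  assumes "t \<in> map_triples G"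
  shows "dual_triple G t \<in> map_triples G"
proof -
  obtain x y z where t: "t = (x, y, z)" by (cases t)
  have c: "x \<in> carrier G" "y \<in> carrier G" "z \<in> carrier G" 
    and gen: "generate G {x, y, z} = carrier G" and o: "ord y = 2" and e: "x \<otimes> y \<otimes> z = \<one>"
    using assms by (auto simp: t map_triples_def)
  let ?w = "inv (z \<otimes> y)"
  have c': "{z, y, ?w} \<subseteq> carrier G" using c by auto
  have sub: "subgroup (generate G {z, y, ?w}) G" by (rule generate_is_subgroup[OF c'])
  have yz: "y \<in> generate G {z, y, ?w}" "z \<in> generate G {z, y, ?w}"
    by (auto intro: generate.incl)
  have "x \<otimes> (y \<otimes> z) = \<one>" using c e by (simp add: m_assoc)
  then have "x = inv (y \<otimes> z)" using c by (metis inv_equality inv_inv m_closed)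
  then have "x \<in> generate G {z, y, ?w}"
    using yz sub by (simp add: subgroup.m_closed subgroup.m_inv_closed)
  then have "generate G {x, y, z} \<subseteq> generate G {z, y, ?w}"
    using yz by (intro generate_subgroup_incl sub) auto
  then have "generate G {z, y, ?w} = carrier G"
    using gen generate_incl[OF c'] by auto
  moreover have "z \<otimes> y \<otimes> ?w = \<one>" using c by simp
  ultimately show ?thesis using c o by (simp add: t map_triples_def)
qed

lemma hole_triple_in_map_triples:
  assumes "(x, y, z) \<in> map_triples G" "coprime j (int (ord x))"
  shows "hole_triple G j (x, y, z) \<in> map_triples G"
proof -
  have c: "x \<in> carrier G" "y \<in> carrier G" "z \<in> carrier G" 
    and gen: "generate G {x, y, z} = carrier G" and o: "ord y = 2" and e: "x \<otimes> y \<otimes> z = \<one>"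
    using assms(1) by (auto simp: map_triples_def)
  let ?x = "x [^] j" and ?w = "inv (x [^] j \<otimes> y)"
  have c': "{?x, y, ?w} \<subseteq> carrier G" using c by auto
  have sub: "subgroup (generate G {?x, y, ?w}) G" by (rule generate_is_subgroup[OF c'])
  have mem: "y \<in> generate G {?x, y, ?w}" "?x \<in> generate G {?x, y, ?w}"
    by (auto intro: generate.incl)
  obtain a b where ab: "a * j + b * int (ord x) = 1"
    using assms(2) by (metis bezout_int coprime_imp_gcd_eq_1)
  have "x = x [^] (j * a + int (ord x) * b)" using ab c by (simp add: mult.commute int_pow_1)
  also have "\<dots> = ?x [^] a \<otimes> (x [^] ord x) [^] b"
    using c by (simp add: int_pow_mult int_pow_pow int_pow_int flip: int_pow_int)
  also have "\<dots> = ?x [^] a" using c by (simp add: int_pow_one)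
  finally have "x \<in> generate G {?x, y, ?w}"
    using mem(2) sub by (metis subgroup_int_pow_closed)
  moreover have "z = inv (x \<otimes> y)" using c e by (metis inv_comm inv_equality m_closed)
  ultimately have "{x, y, z} \<subseteq> generate G {?x, y, ?w}"
    using mem sub by (simp add: subgroup.m_closed subgroup.m_inv_closed)
  then have "generate G {x, y, z} \<subseteq> generate G {?x, y, ?w}"
    by (intro generate_subgroup_incl sub)
  then have "generate G {?x, y, ?w} = carrier G"
    using gen generate_incl[OF c'] by auto
  moreover have "?x \<otimes> y \<otimes> ?w = \<one>" using c by simp
  ultimately show ?thesis using c o by (simp add: map_triples_def)
qed

lemma dual_map_in_regular_maps:
  assumes "M \<in> regular_maps G"
  shows "dual_map G M \<in> regular_maps G"
proof -
  obtain t where t: "t \<in> map_triples G" "M = (\<lambda>\<phi>. apply_triple \<phi> t) ` auto G"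
    using assms by (rule regular_map_rep)
  have "dual_triple G (apply_triple \<phi> t) = apply_triple \<phi> (dual_triple G t)" if "\<phi> \<in> auto G" for \<phi>
  proof -
    interpret group_hom G G \<phi> by (rule autoD[OF that])
    show ?thesis using t(1) by (auto simp: map_triples_def)
  qed
  then have "dual_map G M = (\<lambda>\<phi>. apply_triple \<phi> (dual_triple G t)) ` auto G"
    by (simp add: dual_map_def t(2) image_image)
  then show ?thesis using orbit_in_regular_maps dual_triple_in_map_triples t(1) by simp
qed

lemma hole_map_in_regular_maps:
  assumes "M \<in> regular_maps G" "has_type G M k l" "coprime j (int l)"
  shows "hole_map G j M \<in> regular_maps G"
proof -
  obtain t where t: "t \<in> map_triples G" "M = (\<lambda>\<phi>. apply_triple \<phi> t) ` auto G"
    using assms(1) by (rule regular_map_rep)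
  obtain x y z where xyz: "t = (x, y, z)" by (cases t)
  have c: "x \<in> carrier G" using t(1) by (auto simp: xyz map_triples_def)
  have "ord x = l"
    using assms(2) ord_auto[OF id_in_auto c] id_in_auto by (force simp: has_type_def t(2) xyz)
  then have h: "hole_triple G j t \<in> map_triples G"
    using hole_triple_in_map_triples t(1) assms(3) xyz by blast
  have "hole_triple G j (apply_triple \<phi> t) = apply_triple \<phi> (hole_triple G j t)"
    if "\<phi> \<in> auto G" for \<phi>
  proof -
    interpret group_hom G G \<phi> by (rule autoD[OF that])
    show ?thesis using t(1) by (auto simp: map_triples_def hom_int_pow)
  qed
  then have "hole_map G j M = (\<lambda>\<phi>. apply_triple \<phi> (hole_triple G j t)) ` auto G"
    by (simp add: hole_map_def t(2) image_image)
  then show ?thesis using orbit_in_regular_maps[OF h] by simp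
qed

text \<open>In particular, counting components with \<open>card\<close> is meaningful for finite groups.\<close>

lemma finite_map_components:
  assumes "finite (carrier G)"
  shows "finite (map_components G)"
proof -
  have "map_triples G \<subseteq> carrier G \<times> carrier G \<times> carrier G" by (auto simp: map_triples_def)
  then have "finite (map_triples G)" using assms by (metis finite_SigmaI finite_subset)
  then have "finite (regular_maps G)"
    unfolding regular_maps_def using equiv_triple_equiv
    by (intro finite_quotient) (auto simp: triple_equiv_def)
  then show ?thesis
    unfolding map_components_def by (intro finite_quotient) (auto simp: map_connected_def)
qed

end

end

theory Submission
  imports Defs "HOL-Library.Countable_Set"
begin

text \<open>
  Duality and the hole operations keep the involution \<open>y\<close>, so it suffices to find Hurwitz triples of
  \<open>A\<^sub>n\<close> whose involutions are inequivalent under \<open>Aut A\<^sub>n\<close>.  The size of the conjugacy class of \<open>y\<close> is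
  an invariant under automorphisms, and it is strictly decreasing in the number \<open>f\<close> of fixed points as
  soon as \<open>f\<close> exceeds roughly \<open>sqrt n\<close>.

  Hurwitz triples are obtained by Higman's and Conder's technique of composing coset diagrams.  A chain of
  \<open>I\<close> copies of a diagram of degree 57 and \<open>J\<close> copies of a diagram of degree 49 has \<open>n = 57I + 49J\<close> points,
  and \<open>y\<close> has \<open>I + J + 4\<close> fixed points.  As 57 and 49 are coprime, every large \<open>n\<close> has many such
  representations: replacing \<open>(I, J)\<close> by \<open>(I + 49, J - 57)\<close> preserves \<open>n\<close> and lowers the number of fixed
  points by 8.

  The permutations generate \<open>A\<^sub>n\<close> because a power \<open>g\<close> of the commutator \<open>z\<inverse>yzy\<close> is an 11-cycle.  It shares
  exactly two points with its conjugate \<open>h = zgz\<inverse>\<close>, the commutator of \<open>g\<close> and \<open>h\<close> is a double transposition,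
  and this double transposition shares one point with its conjugate by \<open>g\<^sup>4\<close>, so that their commutator is
  a 3-cycle.  The equivalence relation generated by the 3-cycles of the group is invariant; the class of
  that 3-cycle contains a fixed point of \<open>y\<close> together with its image under \<open>z\<close>, so by transitivity it is
  everything.
\<close>

section \<open>Three-cycles in permutation groups\<close>

locale closed_perms =
  fixes H :: "('a \<Rightarrow> 'a) set"
  assumes comp_closed: "f \<in> H \<Longrightarrow> g \<in> H \<Longrightarrow> f \<circ> g \<in> H"
    and inv_closed: "f \<in> H \<Longrightarrow> inv' f \<in> H"
    and bij: "f \<in> H \<Longrightarrow> bij f"
begin

text \<open>The exponent is a successor because the locale does not postulate the identity.\<close>

lemma funpow_closed:
  assumes "f \<in> H"
  shows "f ^^ Suc n \<in> H"
proof (induction n)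
  case (Suc n)
  have "f \<circ> f ^^ Suc n \<in> H" by (rule comp_closed[OF assms Suc])
  then show ?case by (simp only: funpow.simps(2))
qed (use assms in simp)

definition tri :: "'a \<Rightarrow> 'a \<Rightarrow> 'a \<Rightarrow> bool" where
  "tri a b c \<longleftrightarrow> distinct [a, b, c] \<and> cycle_of_list [a, b, c] \<in> H"

lemma tri_distinct: "tri a b c \<Longrightarrow> a \<noteq> b \<and> b \<noteq> c \<and> a \<noteq> c"
  by (auto simp: tri_def)

lemma tri_rotate: "tri a b c \<Longrightarrow> tri b c a"
proof -
  assume t: "tri a b c"
  have "cycle_of_list [a, b, c] p = cycle_of_list [b, c, a] p" for p
    using tri_distinct[OF t] by (auto simp: transpose_def)
  then have "cycle_of_list [a, b, c] = cycle_of_list [b, c, a]" ..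
  with t show ?thesis unfolding tri_def by auto
qed

lemma tri_reverse: "tri a b c \<Longrightarrow> tri c b a"
proof -
  assume t: "tri a b c"
  have "cycle_of_list [c, b, a] p = (cycle_of_list [a, b, c] \<circ> cycle_of_list [a, b, c]) p" for p
    using tri_distinct[OF t] by (auto simp: transpose_def)
  then have "cycle_of_list [c, b, a] = cycle_of_list [a, b, c] \<circ> cycle_of_list [a, b, c]" ..
  moreover have "\<dots> \<in> H" using t unfolding tri_def by (blast intro: comp_closed)
  ultimately show ?thesis using t unfolding tri_def by auto
qed

lemma tri_swap: "tri a b c \<Longrightarrow> tri a c b"
  by (rule tri_reverse[OF tri_rotate])

lemma tri_image:
  assumes "f \<in> H" "tri a b c"
  shows "tri (f a) (f b) (f c)"
proof -
  have "f \<circ> cycle_of_list [a, b, c] \<circ> inv' f = cycle_of_list (map f [a, b, c])"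
    using assms bij by (intro conjugation_of_cycle) (auto simp: tri_def)
  moreover have "f \<circ> cycle_of_list [a, b, c] \<circ> inv' f \<in> H"
    using assms by (intro comp_closed inv_closed) (auto simp: tri_def)
  ultimately show ?thesis
    using assms(2) inj_eq[OF bij_is_inj[OF bij[OF assms(1)]]] by (simp add: tri_def)
qed

lemma tri_conj:
  assumes "tri r s t" "tri a b c"
  shows "tri (cycle_of_list [r, s, t] a) (cycle_of_list [r, s, t] b) (cycle_of_list [r, s, t] c)"
  using assms by (intro tri_image[of "cycle_of_list [r, s, t]"]) (simp_all add: tri_def)

text \<open>
  An equivalence relation invariant under \<open>H\<close>; its classes are the orbits of the group generated by the
  3-cycles in \<open>H\<close>.
\<close>

definition linked :: "'a \<Rightarrow> 'a \<Rightarrow> bool" where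
  "linked a b \<longleftrightarrow> a = b \<or> (\<exists>c. tri a b c)"

lemma linked_sym: "linked a b \<Longrightarrow> linked b a"
  unfolding linked_def by (elim disjE exE) (auto dest: tri_rotate[OF tri_reverse])

text \<open>Given 3-cycles (p q r) and (q s t), conjugating the first by the second moves q to s and
  fixes p unless t = p. If r = s or t = p, one of the two cycles already contains both p and
  s.\<close>

lemma linked_trans:
  assumes "linked p q" "linked q s"
  shows "linked p s"
proof (cases "p = q \<or> q = s \<or> p = s")
  case True
  then show ?thesis using assms by (auto simp: linked_def)
next
  case False
  then obtain r t where rt: "tri p q r" "tri q s t"
    using assms by (auto simp: linked_def)
  show ?thesis
  proof (cases "r = s \<or> t = p")
    case True
    then have "tri p s q"
      using tri_swap[OF rt(1)] tri_reverse[OF rt(2)] by blast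
    then show ?thesis by (auto simp: linked_def)
  next
    case F: False
    have "cycle_of_list [q, s, t] p = p" "cycle_of_list [q, s, t] q = s"
      using False F tri_distinct[OF rt(2)] by (auto simp: transpose_def)
    then show ?thesis using tri_conj[OF rt(2,1)] by (auto simp: linked_def)
  qed
qed

lemma linked_image: "f \<in> H \<Longrightarrow> linked a b \<Longrightarrow> linked (f a) (f b)"
  unfolding linked_def using tri_image by blast

text \<open>Start from (p q r) and a cycle (r s t) linking r to s. Conjugating the first by the
  second replaces r by s, unless t is p or q. In those cases (r s t) is conjugated by (p q r) or its
  inverse instead.\<close>

lemma tri_of_linked:
  assumes "linked p q" "linked p s" "p \<noteq> q" "p \<noteq> s" "q \<noteq> s"
  shows "tri p q s"
proof -
  obtain r where r: "tri p q r" using assms by (auto simp: linked_def)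
  show ?thesis
  proof (cases "r = s")
    case False
    have "linked r p" using tri_rotate[OF tri_rotate[OF r]] by (auto simp: linked_def)
    from this assms(2) have "linked r s" by (rule linked_trans)
    then obtain t where t: "tri r s t" using False by (auto simp: linked_def)
    note d = tri_distinct[OF r] tri_distinct[OF t]
    consider "t = p" | "t = q" | "t \<noteq> p" "t \<noteq> q" by blast
    then show ?thesis
    proof cases
      case 1
      have "tri (cycle_of_list [p, q, r] r) (cycle_of_list [p, q, r] s) (cycle_of_list [p, q, r] p)"
        using tri_conj[OF r] t 1 by blast
      moreover have "cycle_of_list [p, q, r] r = p" "cycle_of_list [p, q, r] s = s"
        "cycle_of_list [p, q, r] p = q"
        using d assms by (auto simp: transpose_def)
      ultimately have "tri p s q" by simp
      then show ?thesis by (rule tri_swap)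
    next
      case 2
      have "cycle_of_list [r, q, p] r = q" "cycle_of_list [r, q, p] s = s"
        "cycle_of_list [r, q, p] q = p"
        using d assms by (auto simp: transpose_def)
      then have "tri q s p"
        using tri_conj[OF tri_reverse[OF r], of r s q] t 2 tri_reverse[OF r] by auto
      then show ?thesis by (rule tri_rotate[OF tri_rotate])
    next
      case 3
      have "cycle_of_list [r, s, t] p = p" "cycle_of_list [r, s, t] q = q" "cycle_of_list [r, s, t] r = s"
        using d assms 3 by (auto simp: transpose_def)
      then show ?thesis using tri_conj[OF t r] by simp
    qed
  qed (use r in simp)
qed

text \<open>Members of \<open>H\<close> permute the classes, so a single point whose image stays in
  its class forces the whole class to be preserved.\<close>

lemma linked_invariant:
  assumes "f \<in> H" "linked d p" "linked d (f p)" "linked d q"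
  shows "linked d (f q)"
  using assms(3) linked_image[OF assms(1) linked_trans[OF linked_sym[OF assms(2)] assms(4)]]
  by (rule linked_trans)

section \<open>Commutators of permutations with small common support\<close>

text \<open>The equation says that s is the commutator of g and h, written without inverses so that
  it can be checked point by point.\<close>

lemma commutator_closed:
  assumes "g \<in> H" "h \<in> H" "\<And>q. s (h (g q)) = g (h q)"
  shows "s \<in> H"
proof -
  have "s = g \<circ> h \<circ> (inv' g \<circ> inv' h)"
  proof
    fix p
    have "p = h (g (inv' g (inv' h p)))"
      using assms bij by (simp add: bij_is_surj surj_f_inv_f)
    then show "s p = (g \<circ> h \<circ> (inv' g \<circ> inv' h)) p" using assms(3) by (metis comp_apply)
  qed
  then show ?thesis using assms by (auto intro!: comp_closed inv_closed)
qed

lemma tri_commutator: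
  assumes gh: "g \<in> H" "h \<in> H"
    and one: "\<And>p. g p \<noteq> p \<Longrightarrow> h p \<noteq> p \<Longrightarrow> p = a"
    and a: "g a \<noteq> a" "h a \<noteq> a"
  shows "tri a (g a) (h a)"
proof -
  have gi: "g p = g q \<longleftrightarrow> p = q" and hi: "h p = h q \<longleftrightarrow> p = q" for p q
    using bij gh by (auto dest: bij_is_inj injD)
  have hg: "h (g q) = g q" "h q = q" if "g q \<noteq> q" "q \<noteq> a" "g q \<noteq> a" for q
    using that one gi by metis+
  have gh': "g (h q) = h q" "g q = q" if "h q \<noteq> q" "q \<noteq> a" "h q \<noteq> a" for q
    using that one hi by metis+
  have ga: "h (g a) = g a" and ha: "g (h a) = h a" using one a gi hi by metis+
  have ne: "g a \<noteq> h a" using ga ha a hi by metis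
  have c: "cycle_of_list [a, g a, h a] a = g a" "cycle_of_list [a, g a, h a] (g a) = h a"
    "cycle_of_list [a, g a, h a] (h a) = a"
    "p \<noteq> a \<Longrightarrow> p \<noteq> g a \<Longrightarrow> p \<noteq> h a \<Longrightarrow> cycle_of_list [a, g a, h a] p = p" for p
    using a ne by (auto simp: transpose_def)
  have "cycle_of_list [a, g a, h a] (h (g q)) = g (h q)" for q
  proof -
    \<comment> \<open>If none of \<open>q\<close>, \<open>g q\<close>, \<open>h q\<close> is
      \<open>a\<close>, then \<open>g\<close> and \<open>h\<close> commute at \<open>q\<close>, and
      the 3-cycle fixes the image.\<close>
    consider "q = a" | "g q = a" "q \<noteq> a" | "h q = a" "q \<noteq> a" "g q \<noteq> a"
      | "q \<noteq> a" "g q \<noteq> a" "h q \<noteq> a" "g q \<noteq> q" | "q \<noteq> a" "g q \<noteq> a" "h q \<noteq> a" "g q = q"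
      by blast
    then show ?thesis
    proof cases
      case 1 then show ?thesis using c ga ha by simp
    next
      case 2
      then have "h q = q" using one by metis
      then show ?thesis using c 2 by simp
    next
      case 3
      then have "g q = q" using one by metis
      then show ?thesis using c 3 by simp
    next
      case 4
      have "g q \<noteq> g a" "g q \<noteq> h a" using 4 gi ha by metis+
      then show ?thesis using c(4) hg[OF 4(4,1,2)] 4 by simp
    next
      case 5
      have "h q \<noteq> h a" "h q \<noteq> g a" using 5 hi gi ga a by metis+
      moreover have "g (h q) = h q" using 5 gh' by (cases "h q = q") auto
      ultimately show ?thesis using c(4) 5 by simp
    qed
  qed
  then have "cycle_of_list [a, g a, h a] \<in> H" by (rule commutator_closed[OF gh])
  then show ?thesis using a ne unfolding tri_def by force
qed

text \<open>For instance, two cycles that pass through their two common points in opposite directions.\<close>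

lemma double_transposition_commutator:
  assumes gh: "g \<in> H" "h \<in> H"
    and two: "\<And>p. g p \<noteq> p \<Longrightarrow> h p \<noteq> p \<Longrightarrow> p = a \<or> p = b"
    and ab: "a \<noteq> b" "g a = b" "h b = a" "g b = c" "h a = d"
    and cd: "c \<noteq> a" "d \<noteq> b"
  shows "transpose a d \<circ> transpose b c \<in> H" "distinct [a, b, c, d]"
proof -
  have gi: "g p = g q \<longleftrightarrow> p = q" and hi: "h p = h q \<longleftrightarrow> p = q" for p q
    using bij gh by (auto dest: bij_is_inj injD)
  have "d \<noteq> a" "c \<noteq> b" using ab hi gi by metis+
  \<comment> \<open>\<open>c\<close> is moved by \<open>g\<close> and is not a common point, so
    \<open>h\<close> fixes it; symmetrically \<open>g\<close> fixes \<open>d\<close>.\<close>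
  have hc: "h c = c" using two[of c] ab cd \<open>c \<noteq> b\<close> gi by metis
  have gd: "g d = d" using two[of d] ab cd \<open>d \<noteq> a\<close> hi by metis
  have "c \<noteq> d" using hc ab cd hi by metis
  show dis: "distinct [a, b, c, d]" using ab cd \<open>d \<noteq> a\<close> \<open>c \<noteq> b\<close> \<open>c \<noteq> d\<close> by auto
  define s where "s = transpose a d \<circ> transpose b c"
  have s: "s a = d" "s d = a" "s b = c" "s c = b"
    "p \<noteq> a \<Longrightarrow> p \<noteq> b \<Longrightarrow> p \<noteq> c \<Longrightarrow> p \<noteq> d \<Longrightarrow> s p = p" for p
    using dis by (auto simp: s_def transpose_def)
  have "s (h (g q)) = g (h q)" for q
  proof -
    consider "q = a" | "q = b" | "g q = a" "q \<noteq> a" "q \<noteq> b" | "h q = b" "q \<noteq> a" "q \<noteq> b"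
      | "q \<noteq> a" "q \<noteq> b" "g q \<noteq> a" "h q \<noteq> b" "g q \<noteq> q"
      | "q \<noteq> a" "q \<noteq> b" "g q \<noteq> a" "h q \<noteq> b" "g q = q"
      by blast
    then show ?thesis
    proof cases
      case 1 then show ?thesis using s ab gd by simp
    next
      case 2 then show ?thesis using s ab hc by simp
    next
      case 3
      then have "h q = q" using two by metis
      then show ?thesis using s ab 3 by simp
    next
      case 4
      then have "g q = q" using two by metis
      then show ?thesis using s ab 4 by simp
    next
      case 5
      have "g q \<noteq> b" "g q \<noteq> c" "g q \<noteq> d" using 5 ab gd gi by metis+
      moreover have "h q = q" using two 5 by metis
      moreover have "h (g q) = g q" using two[of "g q"] 5 \<open>g q \<noteq> b\<close> gi by metis
      ultimately show ?thesis using s(5) 5 by simp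
    next
      case 6
      have "h q \<noteq> a" using 6 ab hi by metis
      moreover have "h q \<noteq> d" using 6 ab hi by metis
      moreover have "h q \<noteq> c" using 6 ab hc hi gi \<open>c \<noteq> b\<close> by metis
      moreover have "g (h q) = h q" using two[of "h q"] 6 hi calculation(1) by metis
      ultimately show ?thesis using s(5) 6 by simp
    qed
  qed
  then have "s \<in> H" by (rule commutator_closed[OF gh])
  then show "transpose a d \<circ> transpose b c \<in> H" by (simp only: s_def)
qed

text \<open>The double transposition (a d)(b c) and its conjugate by u have only d as a common moved
  point, so their commutator is a 3-cycle through d.\<close>

lemma tri_of_overlap:
  assumes gh: "g \<in> H" "h \<in> H"
    and two: "\<And>p. g p \<noteq> p \<Longrightarrow> h p \<noteq> p \<Longrightarrow> p = a \<or> p = b"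
    and ab: "a \<noteq> b" "g a = b" "h b = a" "g b = c" "h a = d"
    and cd: "c \<noteq> a" "d \<noteq> b"
    and u: "u \<in> H" "u d = d" "u a \<notin> {a, b, c, d}" "u b \<notin> {a, b, c, d}" "u c \<notin> {a, b, c, d}"
  shows "tri d a (u a)"
proof -
  define s where "s = transpose a d \<circ> transpose b c"
  have s: "s \<in> H" and dis: "distinct [a, b, c, d]"
    using double_transposition_commutator[OF gh two ab cd] by (auto simp: s_def)
  define s' where "s' = u \<circ> s \<circ> inv' u"
  have s': "s' \<in> H" unfolding s'_def by (intro comp_closed inv_closed s u(1))
  have iu: "inv' u (u p) = p" "u (inv' u p) = p" for p
    using bij[OF u(1)] by (simp_all add: bij_is_inj bij_is_surj surj_f_inv_f)
  have sv: "s d = a" "s p \<noteq> p \<Longrightarrow> p \<in> {a, b, c, d}" for p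
    using dis by (auto simp: s_def transpose_def split: if_splits)
  have s'd: "s' d = u a" using iu(1)[of d] by (simp add: s'_def u(2) sv(1))
  have "p = d" if "s p \<noteq> p" "s' p \<noteq> p" for p
  proof -
    have "s (inv' u p) \<noteq> inv' u p" using that(2) iu by (auto simp: s'_def)
    then have "inv' u p \<in> {a, b, c, d}" by (rule sv(2))
    then have "p \<in> {u a, u b, u c, u d}" using iu(2)[of p] by auto
    then show ?thesis using sv(2)[OF that(1)] u by auto
  qed
  then have "tri d (s d) (s' d)"
    using dis u(3) sv(1) s'd by (intro tri_commutator s s') auto
  then show ?thesis by (simp add: sv(1) s'd)
qed

end

section \<open>Involutions\<close>

definition involutions :: "nat \<Rightarrow> nat \<Rightarrow> (nat \<Rightarrow> nat) set" where
  "involutions n f = {p. p permutes {1..n} \<and> p \<circ> p = id \<and> card {i \<in> {1..n}. p i = i} = f}"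

lemma finite_involutions: "finite (involutions n f)"
  by (rule finite_subset[OF _ finite_permutations[of "{1..n}"]]) (auto simp: involutions_def)

lemma involutionD:
  assumes "p \<in> involutions n f"
  shows "p permutes {1..n}" "p (p i) = i" "card {i \<in> {1..n}. p i = i} = f"
  using assms by (auto simp: involutions_def fun_eq_iff)

text \<open>Each 2-cycle is counted by its smaller point: p itself matches the points it raises with
  those it lowers.\<close>

lemma card_ascents:
  assumes "p \<in> involutions n f"
  shows "2 * card {i \<in> {1..n}. i < p i} + f = n"
proof -
  note p = involutionD[OF assms]
  let ?A = "{i \<in> {1..n}. i < p i}" and ?D = "{i \<in> {1..n}. p i < i}" and ?F = "{i \<in> {1..n}. p i = i}"
  have "bij_betw p ?A ?D"
    using p(2) permutes_in_image[OF p(1)] by (intro bij_betw_byWitness[where f' = p]) auto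
  then have "card ?D = card ?A" by (rule bij_betw_same_card[symmetric])
  moreover have "card (?A \<union> ?D) = card ?A + card ?D"
    by (rule card_Un_disjoint) auto
  moreover have "card (?A \<union> ?D \<union> ?F) = card (?A \<union> ?D) + card ?F"
    by (rule card_Un_disjoint) auto
  moreover have "?A \<union> ?D \<union> ?F = {1..n}" by auto
  ultimately show ?thesis using p(3) by simp
qed

lemma card_less_pairs:
  fixes F :: "'a :: linorder set"
  assumes "finite F"
  shows "2 * card {(a, b). a \<in> F \<and> b \<in> F \<and> a < b} + card F = card F * card F"
proof -
  let ?L = "{(a, b). a \<in> F \<and> b \<in> F \<and> a < b}"
  let ?G = "{(a, b). a \<in> F \<and> b \<in> F \<and> b < a}"
  let ?D = "(\<lambda>a. (a, a)) ` F"
  have fin: "finite ?L" "finite ?G"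
    by (rule finite_subset[OF _ finite_cartesian_product[OF assms assms]], auto)+
  have "F \<times> F = ?L \<union> ?G \<union> ?D" by auto
  then have "card (?L \<union> ?G \<union> ?D) = card F * card F" by (metis card_cartesian_product)
  moreover have "card (?L \<union> ?G) = card ?L + card ?G"
    by (rule card_Un_disjoint[OF fin]) auto
  moreover have "card (?L \<union> ?G \<union> ?D) = card (?L \<union> ?G) + card ?D"
    by (rule card_Un_disjoint) (use fin assms in auto)
  moreover have "bij_betw prod.swap ?L ?G"
    by (rule bij_betw_byWitness[where f' = prod.swap]) auto
  then have "card ?G = card ?L" by (rule bij_betw_same_card[symmetric])
  moreover have "card ?D = card F" by (rule card_image) (auto simp: inj_on_def)
  ultimately show ?thesis by linarith
qed

text \<open>The alternatives in \<open>pab\<close> serve the two directions of the matching below: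
  dissolving a 2-cycle and creating one.\<close>

lemma involution_mult_transpose:
  assumes p: "p permutes S" "\<And>i. p (p i) = i" and ab: "a \<noteq> b" "a \<in> S" "b \<in> S"
    and pab: "p a = b \<or> p a = a \<and> p b = b"
  shows "p \<circ> transpose a b permutes S" "(p \<circ> transpose a b) \<circ> (p \<circ> transpose a b) = id"
proof -
  show "p \<circ> transpose a b permutes S"
    by (intro permutes_compose p permutes_swap_id ab)
  have "p b = a" if "p a = b" using p(2)[of a] that by simp
  then have "p (transpose a b x) = transpose a b (p x)" for x
    using pab p(2) by (metis transpose_apply_first transpose_apply_other transpose_apply_second)
  then show "(p \<circ> transpose a b) \<circ> (p \<circ> transpose a b) = id"
    using p(2) by (simp add: fun_eq_iff)
qed

text \<open>
  Multiplication by a transposition \<open>(a b)\<close> matches the 2-cycles of the involutions with \<open>f\<close> fixed points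
  with the pairs of fixed points of the involutions with \<open>f + 2\<close> fixed points.
\<close>

lemma involutions_recurrence:
  "\<exists>M L. M * card (involutions n f) = L * card (involutions n (f + 2))
     \<and> (involutions n f \<noteq> {} \<longrightarrow> 2 * M + f = n) \<and> 2 * L + (f + 2) = (f + 2) * (f + 2)"
proof -
  let ?asc = "\<lambda>p. {(a, b). a \<in> {1..n} \<and> a < b \<and> p a = b}"
  let ?fix = "\<lambda>q. {(a, b). a \<in> {i \<in> {1..n}. q i = i} \<and> b \<in> {i \<in> {1..n}. q i = i} \<and> a < b}"
  let ?A = "Sigma (involutions n f) ?asc" and ?B = "Sigma (involutions n (f + 2)) ?fix"
  let ?\<phi> = "\<lambda>(p, a, b). (p \<circ> transpose a b, a, b :: nat)"
  \<comment> \<open>\<open>M\<close> counts the 2-cycles of an involution with f fixed points,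
    \<open>L\<close> the pairs among f + 2 fixed points; the recurrence counts the matched pairs in
    both ways.\<close>
  define M where "M = (n - f) div 2"
  define L where "L = ((f + 2) * (f + 2) - (f + 2)) div 2"
  have M: "2 * M + f = n" if "p \<in> involutions n f" for p
  proof -
    have "n - f = 2 * card {i \<in> {1..n}. i < p i}" using card_ascents[OF that] by linarith
    then have "M = card {i \<in> {1..n}. i < p i}" unfolding M_def by linarith
    then show ?thesis using card_ascents[OF that] by simp
  qed
  have L: "2 * L + (f + 2) = (f + 2) * (f + 2)"
  proof -
    have "(f + 2) * (f + 2) - (f + 2) = (f + 2) * (f + 1)" by (simp add: algebra_simps)
    moreover have "even ((f + 2) * (f + 1))" by simp
    ultimately show ?thesis unfolding L_def by (simp add: algebra_simps)
  qed
  have card_asc: "card (?asc p) = M" if "p \<in> involutions n f" for p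
  proof -
    have "bij_betw (\<lambda>a. (a, p a)) {a \<in> {1..n}. a < p a} (?asc p)"
      by (rule bij_betw_byWitness[where f' = fst]) auto
    then show ?thesis using card_ascents[OF that] M[OF that] by (simp add: bij_betw_same_card[symmetric])
  qed
  have card_fix: "card (?fix q) = L" if "q \<in> involutions n (f + 2)" for q
    using card_less_pairs[of "{i \<in> {1..n}. q i = i}"] involutionD(3)[OF that] L by simp
  have AB: "?\<phi> t \<in> ?B" if "t \<in> ?A" for t
  proof -
    obtain p a b where t: "t = (p, a, b)" by (cases t)
    with that have p: "p \<in> involutions n f" and ab: "a \<in> {1..n}" "a < b" "p a = b" by auto
    note d = involutionD[OF p]
    have b: "b \<in> {1..n}" using permutes_in_image[OF d(1)] ab by blast
    have pb: "p b = a" using d(2)[of a] ab by simp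
    let ?q = "p \<circ> transpose a b"
    have q: "?q permutes {1..n}" "?q \<circ> ?q = id"
      using involution_mult_transpose[OF d(1,2), of a b] ab b by auto
    have "{i \<in> {1..n}. ?q i = i} = insert a (insert b {i \<in> {1..n}. p i = i})"
      using ab b pb by (auto simp: transpose_def)
    moreover have "card (insert a (insert b {i \<in> {1..n}. p i = i})) = f + 2"
      using d(3) ab pb by (subst card_insert_disjoint, auto)+
    ultimately have "card {i \<in> {1..n}. ?q i = i} = f + 2" by simp
    then show ?thesis using q t ab b pb by (simp add: involutions_def)
  qed
  have BA: "?\<phi> t \<in> ?A" if "t \<in> ?B" for t
  proof -
    obtain q a b where t: "t = (q, a, b)" by (cases t)
    with that have q: "q \<in> involutions n (f + 2)"
      and ab: "a \<in> {1..n}" "b \<in> {1..n}" "a < b" "q a = a" "q b = b" by auto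
    note d = involutionD[OF q]
    let ?p = "q \<circ> transpose a b"
    have p: "?p permutes {1..n}" "?p \<circ> ?p = id"
      using involution_mult_transpose[OF d(1,2), of a b] ab by auto
    have "{i \<in> {1..n}. ?p i = i} = {i \<in> {1..n}. q i = i} - {a, b}"
      using ab by (auto simp: transpose_def)
    then have "card {i \<in> {1..n}. ?p i = i} = f"
      using d(3) ab by (simp add: card_Diff_subset)
    then show ?thesis using p t ab by (simp add: involutions_def)
  qed
  have "?\<phi> (?\<phi> t) = t" for t
    by (cases t) (simp add: comp_assoc)
  then have "bij_betw ?\<phi> ?A ?B"
    using AB BA by (intro bij_betw_byWitness[where f' = ?\<phi>]) blast+
  then have "card ?A = card ?B" by (rule bij_betw_same_card)
  moreover have "finite (?asc p)" for p :: "nat \<Rightarrow> nat"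
    by (rule finite_subset[of _ "(\<lambda>a. (a, p a)) ` {1..n}"]) auto
  then have "card ?A = (\<Sum>p\<in>involutions n f. card (?asc p))"
    by (intro card_SigmaI finite_involutions ballI)
  then have "card ?A = card (involutions n f) * M" using card_asc by simp
  moreover have "finite (?fix q)" for q :: "nat \<Rightarrow> nat"
    by (rule finite_subset[of _ "{1..n} \<times> {1..n}"]) auto
  then have "card ?B = (\<Sum>q\<in>involutions n (f + 2). card (?fix q))"
    by (intro card_SigmaI finite_involutions ballI)
  then have "card ?B = card (involutions n (f + 2)) * L" using card_fix by simp
  ultimately have "M * card (involutions n f) = L * card (involutions n (f + 2))"
    by (metis mult.commute)
  then show ?thesis using M L by blast
qed

text \<open>In the recurrence 2M = n - f and 2L = (f + 2)(f + 1), so the bound on n says exactly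
  that M < L.\<close>

lemma card_involutions_decreasing_step:
  assumes "involutions n (f + 2) \<noteq> {}" "n < (f + 2) * (f + 1) + f"
  shows "card (involutions n (f + 2)) < card (involutions n f)"
proof -
  obtain M L where rec: "M * card (involutions n f) = L * card (involutions n (f + 2))"
    "involutions n f \<noteq> {} \<longrightarrow> 2 * M + f = n" "2 * L + (f + 2) = (f + 2) * (f + 2)"
    using involutions_recurrence by blast
  have pos: "0 < card (involutions n (f + 2))"
    using assms(1) finite_involutions by (simp add: card_gt_0_iff)
  have "2 * L = (f + 2) * (f + 1)" using rec(3) by (simp add: algebra_simps)
  then have "0 < L" by simp
  then have "0 < M * card (involutions n f)" using rec(1) pos by simp
  then have "involutions n f \<noteq> {}" and "0 < M" by auto
  then have "M < L" using rec(2) \<open>2 * L = _\<close> assms(2) by simp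
  then have "M * card (involutions n (f + 2)) < M * card (involutions n f)"
    unfolding rec(1) using pos by simp
  then show ?thesis by simp
qed

text \<open>The bound on n becomes weaker as f grows, so the single step can be iterated; its strict
  inequality also hands nonemptiness down to smaller numbers of fixed points.\<close>

lemma card_involutions_decreasing:
  assumes "involutions n (f + 2 * d) \<noteq> {}" "n < (f + 2) * (f + 1) + f" "0 < d"
  shows "card (involutions n (f + 2 * d)) < card (involutions n f)"
  using assms(1,3)
proof (induction d)
  case (Suc d)
  have "(f + 2) * (f + 1) + f \<le> (f + 2 * d + 2) * (f + 2 * d + 1) + (f + 2 * d)"
    by (intro add_mono mult_mono) auto
  then have *: "card (involutions n (f + 2 * Suc d)) < card (involutions n (f + 2 * d))"
    using card_involutions_decreasing_step[of n "f + 2 * d"] Suc.prems assms(2)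
    by (simp add: add.assoc)
  show ?case
  proof (cases "d = 0")
    case False
    moreover have "involutions n (f + 2 * d) \<noteq> {}" using * by auto
    ultimately show ?thesis using * Suc.IH by simp
  qed (use * in simp)
qed simp

section \<open>Conjugacy classes of involutions\<close>

text \<open>Match the smaller points of the 2-cycles and the fixed points arbitrarily; the larger
  points are then forced by equivariance.\<close>

lemma involutions_conjugate:
  assumes p: "p \<in> involutions n f" and q: "q \<in> involutions n f"
  obtains s where "s permutes {1..n}" "s \<circ> p = q \<circ> s"
proof -
  note pd = involutionD[OF p] and qd = involutionD[OF q]
  let ?A = "\<lambda>p. {i \<in> {1..n}. i < p i}" and ?D = "\<lambda>p. {i \<in> {1..n}. p i < i}"
    and ?F = "\<lambda>p. {i \<in> {1..n}. p i = i}"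
  have "card (?A p) = card (?A q)" using card_ascents[OF p] card_ascents[OF q] by simp
  then have "\<exists>\<alpha>. bij_betw \<alpha> (?A p) (?A q)"
    by (intro finite_same_card_bij) simp_all
  then obtain \<alpha> where \<alpha>: "bij_betw \<alpha> (?A p) (?A q)" ..
  have "card (?F p) = card (?F q)" using pd(3) qd(3) by simp
  then have "\<exists>\<gamma>. bij_betw \<gamma> (?F p) (?F q)"
    by (intro finite_same_card_bij) simp_all
  then obtain \<gamma> where \<gamma>: "bij_betw \<gamma> (?F p) (?F q)" ..
  have AD: "bij_betw r (?A r) (?D r)" "bij_betw r (?D r) (?A r)" if "r \<in> involutions n f" for r
    by (rule bij_betw_byWitness[where f' = r];
      use involutionD(2)[OF that] permutes_in_image[OF involutionD(1)[OF that]] in auto)+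
  define s where "s x = (if x \<in> ?A p then \<alpha> x else if x \<in> ?F p then \<gamma> x
    else if x \<in> ?D p then q (\<alpha> (p x)) else x)" for x
  have sA: "bij_betw s (?A p) (?A q)"
    using \<alpha> by (rule bij_betw_cong[THEN iffD1, rotated]) (simp add: s_def)
  have sF: "bij_betw s (?F p) (?F q)"
    using \<gamma> by (rule bij_betw_cong[THEN iffD1, rotated]) (auto simp: s_def)
  have "bij_betw (q \<circ> (\<alpha> \<circ> p)) (?D p) (?D q)"
    by (intro bij_betw_trans[OF bij_betw_trans[OF AD(2)[OF p] \<alpha>] AD(1)[OF q]])
  then have sD: "bij_betw s (?D p) (?D q)"
    by (rule bij_betw_cong[THEN iffD1, rotated]) (auto simp: s_def)
  have "bij_betw s (?A p \<union> ?F p \<union> ?D p) (?A q \<union> ?F q \<union> ?D q)"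
    by (intro bij_betw_combine sA sF sD) auto
  moreover have "?A r \<union> ?F r \<union> ?D r = {1..n}" for r by auto
  ultimately have "bij_betw s {1..n} {1..n}" by simp
  then have s: "s permutes {1..n}"
    by (rule bij_imp_permutes) (auto simp: s_def)
  have "s (p x) = q (s x)" for x
  proof -
    consider "x \<in> ?A p" | "x \<in> ?F p" | "x \<in> ?D p" | "x \<notin> {1..n}"
      by (cases "x < p x"; cases "p x = x") force+
    then show ?thesis
    proof cases
      case 1
      then have "p x \<in> ?D p" using AD(1)[OF p] by (auto simp: bij_betw_def)
      then show ?thesis using 1 pd(2) by (auto simp: s_def)
    next
      case 2
      then have "s x \<in> ?F q" using sF by (auto simp: bij_betw_def)
      then show ?thesis using 2 by auto
    next
      case 3
      then have "p x \<in> ?A p" using AD(2)[OF p] by (auto simp: bij_betw_def)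
      moreover have "s x = q (\<alpha> (p x))" using 3 by (auto simp: s_def)
      ultimately show ?thesis using qd(2) by (simp add: s_def)
    next
      case 4
      then have "p x = x" "q (s x) = s x" "s x = x"
        using pd(1) qd(1) s by (auto simp: permutes_def)
      then show ?thesis by simp
    qed
  qed
  then show ?thesis using that s by (auto simp: fun_eq_iff)
qed

definition conj_class :: "('a, 'b) monoid_scheme \<Rightarrow> 'a \<Rightarrow> 'a set" where
  "conj_class G y = (\<lambda>g. g \<otimes>\<^bsub>G\<^esub> y \<otimes>\<^bsub>G\<^esub> inv\<^bsub>G\<^esub> g) ` carrier G"

text \<open>The class under the alternating group is the full class under the symmetric group
  because y commutes with an odd permutation, namely one of its own 2-cycles; f < n guarantees that
  there is one.\<close>

lemma conj_class_involution:
  assumes y: "y \<in> involutions n f" and "f < n"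
  shows "conj_class (alt_group n) y = involutions n f"
proof (intro subset_antisym subsetI)
  note yd = involutionD[OF y]
  fix q assume "q \<in> conj_class (alt_group n) y"
  then obtain g where g: "g \<in> carrier (alt_group n)" "q = g \<circ> y \<circ> inv' g"
    by (auto simp: conj_class_def alt_group_mult alt_group_inv_equality)
  have gp: "g permutes {1..n}" using g by (simp add: alt_group_carrier)
  have ig: "inv' g (g x) = x" "g (inv' g x) = x" for x
    using permutes_inverses[OF gp] by simp_all
  have "q permutes {1..n}" unfolding g(2) by (intro permutes_compose permutes_inv gp yd(1))
  moreover have "q \<circ> q = id" using ig yd(2) by (simp add: g(2) fun_eq_iff)
  moreover have "{i \<in> {1..n}. q i = i} = g ` {i \<in> {1..n}. y i = i}"
  proof (intro subset_antisym subsetI)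
    fix i assume "i \<in> {i \<in> {1..n}. q i = i}"
    then have "i \<in> {1..n}" "g (y (inv' g i)) = i" by (auto simp: g(2))
    then have "inv' g i \<in> {1..n}" "y (inv' g i) = inv' g i"
      using permutes_in_image[OF permutes_inv[OF gp]] ig by (blast, metis)
    then show "i \<in> g ` {i \<in> {1..n}. y i = i}" using ig(2) by (metis (mono_tags, lifting) image_eqI mem_Collect_eq)
  qed (use permutes_in_image[OF gp] ig in \<open>auto simp: g(2)\<close>)
  then have "card {i \<in> {1..n}. q i = i} = f"
    using yd(3) permutes_inj_on[OF gp] by (simp add: card_image)
  ultimately show "q \<in> involutions n f" by (simp add: involutions_def)
next
  note yd = involutionD[OF y]
  fix q assume q: "q \<in> involutions n f"
  obtain s where s: "s permutes {1..n}" "s \<circ> y = q \<circ> s" using involutions_conjugate[OF y q] .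
  have "\<not> (\<forall>a \<in> {1..n}. y a = a)"
  proof
    assume "\<forall>a \<in> {1..n}. y a = a"
    then have "{a \<in> {1..n}. y a = a} = {1..n}" by blast
    then show False using yd(3) assms(2) by simp
  qed
  then obtain a where a: "a \<in> {1..n}" "y a \<noteq> a" by blast
  let ?t = "transpose a (y a)"
  have t: "?t permutes {1..n}" using a permutes_in_image[OF yd(1)] by (intro permutes_swap_id) auto
  have ty: "?t \<circ> y = y \<circ> ?t"
    using yd(2) by (auto simp: fun_eq_iff transpose_def) (metis yd(2))+
  obtain g where g: "g permutes {1..n}" "evenperm g" "g \<circ> y = q \<circ> g"
  proof (cases "evenperm s")
    case True
    then show ?thesis using that s by blast
  next
    case False
    have "evenperm (s \<circ> ?t)"
      using False a(2) evenperm_comp[OF permutes_imp_permutation[OF _ s(1)] permutes_imp_permutation[OF _ t]]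
      by (simp add: evenperm_swap)
    moreover have "(s \<circ> ?t) \<circ> y = q \<circ> (s \<circ> ?t)" using s(2) ty by (metis comp_assoc)
    ultimately show ?thesis using that permutes_compose[OF t s(1)] by blast
  qed
  have "q = g \<circ> y \<circ> inv' g" using g(3) permutes_inv_o(1)[OF g(1)] by (metis comp_assoc comp_id)
  then show "q \<in> conj_class (alt_group n) y"
    using g by (auto simp: conj_class_def alt_group_carrier alt_group_mult alt_group_inv_equality intro!: image_eqI[of _ _ g])
qed

section \<open>Chains of coset diagrams\<close>

lemma list_all_upt: "list_all P [m..<n] \<longleftrightarrow> (\<forall>i. m \<le> i \<longrightarrow> i < n \<longrightarrow> P i)"
  by (auto simp: list_all_iff)

text \<open>The premise says that f runs cyclically through c, so the n-th power of f acts on c as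
  rotation by n places.\<close>

lemma funpow_cycle:
  assumes "map f c = rotate1 c" "p \<in> set c"
  shows "(f ^^ length c) p = p"
proof -
  have "map (f ^^ n) c = rotate n c" for n
  proof (induction n)
    case (Suc n)
    have "map (f ^^ Suc n) c = map f (map (f ^^ n) c)" by (simp add: comp_def)
    also have "\<dots> = rotate1 (rotate n c)"
      using Suc assms(1) by (metis rotate1_rotate_swap rotate_map)
    finally show ?case by (simp only: rotate_Suc)
  qed simp
  then have "map (f ^^ length c) c = map id c" by simp
  then show ?thesis using assms(2) unfolding map_eq_conv by simp
qed

text \<open>The divisibility is stated over the integers because the simplifier evaluates it there.\<close>

lemma funpow_cycles:
  assumes "\<forall>c \<in> set cs. map f c = rotate1 c \<and> int (length c) dvd int k" "p \<in> set (concat cs)"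
  shows "(f ^^ k) p = p"
proof -
  obtain c where c: "c \<in> set cs" "p \<in> set c" using assms(2) by auto
  then obtain m where "k = length c * m" using assms(1) unfolding int_dvd_int_iff by (blast elim: dvdE)
  moreover have "(f ^^ length c) p = p" using funpow_cycle assms(1) c by metis
  then have "((f ^^ length c) ^^ m) p = p" by (induction m) auto
  ultimately show ?thesis by (simp add: funpow_mult mult.commute)
qed

text \<open>
  Two coset diagrams of the triangle group \<open>(2,3,7)\<close>, of degrees 57 and 49, found by computer search:
  entry \<open>i\<close> of a list is the image of the point \<open>i\<close> under \<open>z\<close>, respectively \<open>y\<close>.  The points are
  numbered so that \<open>y\<close> fixes exactly 0, 1, 2, 3, 4; the pairs \<open>(0, 1)\<close> and \<open>(2, 3)\<close> are handles in
  the sense of Higman and Conder, i.e. the product of order 7 takes one of the two points to the other.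
\<close>

definition zP :: "nat list" where
  "zP = [1, 54, 3, 47, 5, 6, 4, 9, 11, 10, 7, 12, 8, 17, 19, 21, 23, 18, 13, 20, 14, 22, 15, 24,
     16, 32, 34, 36, 30, 39, 38, 41, 33, 25, 35, 26, 37, 27, 28, 40, 29, 42, 31, 49, 46,
     51, 50, 2, 43, 48, 44, 52, 45, 55, 0, 56, 53]"

definition yP :: "nat list" where
  "yP = [0, 1, 2, 3, 4, 7, 8, 5, 6, 13, 14, 15, 16, 9, 10, 11, 12, 25, 26, 27, 28, 29, 30, 31, 32,
     17, 18, 19, 20, 21, 22, 23, 24, 43, 44, 45, 46, 41, 39, 38, 47, 37, 48, 33, 34, 35,
     36, 40, 42, 53, 52, 54, 50, 49, 51, 56, 55]"

definition zQ :: "nat list" where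
  "zQ = [1, 47, 3, 48, 5, 6, 4, 9, 8, 10, 7, 12, 13, 11, 15, 16, 14, 19, 21, 20, 17, 22, 18, 25,
     27, 26, 23, 28, 24, 33, 35, 37, 39, 34, 29, 36, 30, 38, 31, 40, 32, 44, 43, 46, 45,
     41, 42, 0, 2]"

definition yQ :: "nat list" where
  "yQ = [0, 1, 2, 3, 4, 7, 8, 5, 6, 11, 12, 9, 10, 14, 13, 17, 18, 15, 16, 22, 23, 24, 19, 20, 21,
     29, 30, 31, 32, 25, 26, 27, 28, 41, 39, 42, 37, 36, 43, 34, 44, 33, 35, 38, 40, 47,
     48, 45, 46]"

lemmas table_defs = zP_def yP_def zQ_def yQ_def

lemma zP: "i < 57 \<Longrightarrow> zP ! i < 57 \<and> zP ! (zP ! (zP ! i)) = i"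
proof -
  have "list_all (\<lambda>i. zP ! i < 57 \<and> zP ! (zP ! (zP ! i)) = i) [0..<57]" by code_simp
  then show "i < 57 \<Longrightarrow> ?thesis" unfolding list_all_upt by blast
qed

lemma zQ: "i < 49 \<Longrightarrow> zQ ! i < 49 \<and> zQ ! (zQ ! (zQ ! i)) = i"
proof -
  have "list_all (\<lambda>i. zQ ! i < 49 \<and> zQ ! (zQ ! (zQ ! i)) = i) [0..<49]" by code_simp
  then show "i < 49 \<Longrightarrow> ?thesis" unfolding list_all_upt by blast
qed

text \<open>The range starts at 4 because \<open>ymap\<close> treats the handle points 0 to 3
  separately.\<close>

lemma yP:
  "4 \<le> i \<Longrightarrow> i < 57 \<Longrightarrow> 4 \<le> yP ! i \<and> yP ! i < 57 \<and> yP ! (yP ! i) = i \<and> (yP ! i = i \<longleftrightarrow> i = 4)"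
proof -
  have "list_all (\<lambda>i. 4 \<le> yP ! i \<and> yP ! i < 57 \<and> yP ! (yP ! i) = i \<and> (yP ! i = i \<longleftrightarrow> i = 4)) [4..<57]"
    by code_simp
  then show "4 \<le> i \<Longrightarrow> i < 57 \<Longrightarrow> ?thesis" unfolding list_all_upt by blast
qed

lemma yQ:
  "4 \<le> i \<Longrightarrow> i < 49 \<Longrightarrow> 4 \<le> yQ ! i \<and> yQ ! i < 49 \<and> yQ ! (yQ ! i) = i \<and> (yQ ! i = i \<longleftrightarrow> i = 4)"
proof -
  have "list_all (\<lambda>i. 4 \<le> yQ ! i \<and> yQ ! i < 49 \<and> yQ ! (yQ ! i) = i \<and> (yQ ! i = i \<longleftrightarrow> i = 4)) [4..<49]"
    by code_simp
  then show "4 \<le> i \<Longrightarrow> i < 49 \<Longrightarrow> ?thesis" unfolding list_all_upt by blast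
qed

text \<open>
  \<open>I\<close> copies of the first diagram followed by \<open>J\<close> copies of the second; \<open>(b, i)\<close> is the point \<open>i\<close> of
  the \<open>b\<close>-th copy.  The right handle of each copy is joined to the left handle of the next one, which
  preserves the orders 2, 3 and 7.
\<close>

locale diagram_chain =
  fixes I J :: nat
  assumes I_pos: "0 < I" and J_pos: "0 < J"
begin

definition pts :: "(nat \<times> nat) set" where
  "pts = Sigma {..<I + J} (\<lambda>b. {..<if b < I then 57 else 49})"

definition zmap :: "nat \<times> nat \<Rightarrow> nat \<times> nat" where
  "zmap = (\<lambda>(b, i). if (b, i) \<in> pts then (b, (if b < I then zP else zQ) ! i) else (b, i))"

definition ymap :: "nat \<times> nat \<Rightarrow> nat \<times> nat" where
  "ymap = (\<lambda>(b, i). if (b, i) \<notin> pts then (b, i)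
     else if i < 2 then (if b = 0 then (b, i) else (b - 1, i + 2))
     else if i < 4 then (if Suc b < I + J then (Suc b, i - 2) else (b, i))
     else (b, (if b < I then yP else yQ) ! i))"

text \<open>This product is the inverse of the generator \<open>x\<close> of the map.\<close>

definition xmap :: "nat \<times> nat \<Rightarrow> nat \<times> nat" where
  "xmap = ymap \<circ> zmap"

text \<open>
  The commutator \<open>z\<inverse>yzy\<close>.  None of its cycles crosses more than one joint, so that the cycle lengths
  stay bounded along the chain: they are 1, 13, 17, 18, 19, 21, and 11 for a single cycle at the open
  left handle.  The exponent 4232592 used below is divisible by these numbers except 11, modulo which
  it is 1.
\<close>

definition wmap :: "nat \<times> nat \<Rightarrow> nat \<times> nat" where
  "wmap = zmap \<circ> zmap \<circ> ymap \<circ> zmap \<circ> ymap"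

lemma zmap_P: "b < I \<Longrightarrow> i < 57 \<Longrightarrow> zmap (b, i) = (b, zP ! i)"
  by (auto simp: zmap_def pts_def)
lemma zmap_Q: "I \<le> b \<Longrightarrow> b < I + J \<Longrightarrow> i < 49 \<Longrightarrow> zmap (b, i) = (b, zQ ! i)"
  by (auto simp: zmap_def pts_def)
lemma ymap_P: "b < I \<Longrightarrow> i < 57 \<Longrightarrow> 4 \<le> i \<Longrightarrow> ymap (b, i) = (b, yP ! i)"
  by (auto simp: ymap_def pts_def)
lemma ymap_Q: "I \<le> b \<Longrightarrow> b < I + J \<Longrightarrow> i < 49 \<Longrightarrow> 4 \<le> i \<Longrightarrow> ymap (b, i) = (b, yQ ! i)"
  by (auto simp: ymap_def pts_def)
lemma ymap_L: "Suc b < I + J \<Longrightarrow> i < 2 \<Longrightarrow> ymap (Suc b, i) = (b, i + 2)"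
  by (auto simp: ymap_def pts_def)
lemma ymap_R: "Suc b < I + J \<Longrightarrow> 2 \<le> i \<Longrightarrow> i < 4 \<Longrightarrow> ymap (b, i) = (Suc b, i - 2)"
  by (auto simp: ymap_def pts_def)
lemma ymap_first: "i < 2 \<Longrightarrow> ymap (0, i) = (0, i)"
  by (auto simp: ymap_def)
lemma ymap_last: "Suc b = I + J \<Longrightarrow> 2 \<le> i \<Longrightarrow> i < 4 \<Longrightarrow> ymap (b, i) = (b, i)"
  by (auto simp: ymap_def)
lemma map_outside: "p \<notin> pts \<Longrightarrow> zmap p = p" "p \<notin> pts \<Longrightarrow> ymap p = p"
  by (auto simp: zmap_def ymap_def split: prod.splits)

lemmas map_simps = zmap_P zmap_Q ymap_P ymap_Q ymap_L ymap_R ymap_first ymap_last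

lemma pts_cases [consumes 1, case_names P Q]:
  assumes "p \<in> pts"
  obtains b i where "p = (b, i)" "b < I" "i < 57"
    | b i where "p = (b, i)" "I \<le> b" "b < I + J" "i < 49"
  using assms by (auto simp: pts_def split: if_splits)

text \<open>The cases follow the action of y: open left handle, joint seen from the right and from
  the left, open right handle, interior of either kind of copy.\<close>

lemma pts_ycases [consumes 1]:
  assumes "p \<in> pts"
  obtains i where "p = (0, i)" "i < 2"
    | b i where "p = (Suc b, i)" "i < 2" "Suc b < I + J"
    | b i where "p = (b, i)" "2 \<le> i" "i < 4" "Suc b < I + J"
    | b i where "p = (b, i)" "2 \<le> i" "i < 4" "Suc b = I + J"
    | b i where "p = (b, i)" "4 \<le> i" "i < 57" "b < I"
    | b i where "p = (b, i)" "4 \<le> i" "i < 49" "I \<le> b" "b < I + J"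
proof -
  obtain b i where p: "p = (b, i)" "b < I + J" "b < I \<Longrightarrow> i < 57" "I \<le> b \<Longrightarrow> i < 49"
    using assms by (auto simp: pts_def split: if_splits)
  consider "i < 2" | "2 \<le> i" "i < 4" | "4 \<le> i" by linarith
  then show ?thesis
  proof cases
    case 1
    then show ?thesis using p that(1,2) by (cases b) auto
  next
    case 2
    then show ?thesis using p that(3,4)[of b i] by (cases "Suc b = I + J") auto
  next
    case 3
    then show ?thesis using p that(5,6)[of b i] by (cases "b < I") auto
  qed
qed

lemma finite_pts: "finite pts"
  by (auto simp: pts_def)

lemma card_pts: "card pts = 57 * I + 49 * J"
proof -
  have "pts = {..<I} \<times> {..<57} \<union> {I..<I + J} \<times> {..<49}"
    by (auto simp: pts_def split: if_splits)
  moreover have "card ({..<I} \<times> {..<57 :: nat} \<union> {I..<I + J} \<times> {..<49 :: nat}) = 57 * I + 49 * J"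
    by (subst card_Un_disjoint) (auto simp: card_cartesian_product)
  ultimately show ?thesis by simp
qed

lemma zmap_closed:
  assumes "p \<in> pts"
  shows "zmap p \<in> pts"
  using assms
proof (cases rule: pts_cases)
  case (P b i)
  then show ?thesis using zP[of i] J_pos by (auto simp: zmap_P pts_def)
next
  case (Q b i)
  then show ?thesis using zQ[of i] by (auto simp: zmap_Q pts_def)
qed

lemma zmap_cube: "zmap (zmap (zmap p)) = p"
proof (cases "p \<in> pts")
  case True
  then show ?thesis
  proof (cases rule: pts_cases)
    case (P b i)
    then show ?thesis using zP[of i] zP[of "zP ! i"] by (simp add: zmap_P)
  next
    case (Q b i)
    then show ?thesis using zQ[of i] zQ[of "zQ ! i"] by (simp add: zmap_Q)
  qed
qed (simp add: map_outside)

lemma ymap_ymap: "ymap (ymap p) = p"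
proof (cases "p \<in> pts")
  case True
  then show ?thesis
  proof (cases rule: pts_ycases)
    case 1
    then show ?thesis by (simp add: ymap_first)
  next
    case 2
    then show ?thesis by (simp add: ymap_L ymap_R)
  next
    case 3
    then show ?thesis by (simp add: ymap_L ymap_R)
  next
    case 4
    then show ?thesis by (simp add: ymap_last)
  next
    case (5 b i)
    then show ?thesis using yP[of i] by (simp add: ymap_P)
  next
    case (6 b i)
    then show ?thesis using yQ[of i] by (simp add: ymap_Q)
  qed
qed (simp add: map_outside)

lemma ymap_closed: "p \<in> pts \<Longrightarrow> ymap p \<in> pts"
  using map_outside(2)[of "ymap p"] ymap_ymap[of p] by metis

lemma zmap_permutes: "zmap permutes pts"
proof (rule bij_imp_permutes)
  show "bij_betw zmap pts pts"
    by (rule bij_betw_byWitness[where f' = "zmap \<circ> zmap"]) (auto simp: zmap_cube zmap_closed)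
qed (rule map_outside)

lemma ymap_permutes: "ymap permutes pts"
proof (rule bij_imp_permutes)
  show "bij_betw ymap pts pts"
    by (rule bij_betw_byWitness[where f' = ymap]) (auto simp: ymap_ymap ymap_closed)
qed (rule map_outside)

lemma fixed_points: "{p \<in> pts. ymap p = p} =
  {(0, 0), (0, 1), (I + J - 1, 2), (I + J - 1, 3)} \<union> (\<lambda>b. (b, 4)) ` {..<I + J}" (is "?L = ?R")
proof (intro subset_antisym subsetI)
  fix p assume "p \<in> ?L"
  then have "p \<in> pts" and f: "ymap p = p" by auto
  from this(1) show "p \<in> ?R"
  proof (cases rule: pts_ycases)
    case 1
    then show ?thesis by auto
  next
    case 2
    then show ?thesis using f by (simp add: ymap_L)
  next
    case 3
    then show ?thesis using f by (simp add: ymap_R)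
  next
    case (4 b i)
    then have "b = I + J - 1" "i = 2 \<or> i = 3" by auto
    then show ?thesis using 4(1) by auto
  next
    case (5 b i)
    then show ?thesis using f yP[of i] by (simp add: ymap_P)
  next
    case (6 b i)
    then show ?thesis using f yQ[of i] by (simp add: ymap_Q)
  qed
next
  fix p assume "p \<in> ?R"
  then consider i where "p = (0, i)" "i < 2" | i where "p = (I + J - 1, i)" "2 \<le> i" "i < 4"
    | b where "p = (b, 4)" "b < I + J" by auto
  then show "p \<in> ?L"
  proof cases
    case 1
    then show ?thesis using I_pos by (auto simp: pts_def ymap_first)
  next
    case 2
    then show ?thesis using I_pos J_pos by (auto simp: pts_def ymap_last)
  next
    case 3
    then show ?thesis using yP[of 4] yQ[of 4] by (cases "b < I") (auto simp: pts_def ymap_P ymap_Q)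
  qed
qed

lemma card_fixed_points: "card {p \<in> pts. ymap p = p} = I + J + 4"
proof -
  let ?A = "{(0, 0), (0, 1), (I + J - 1, 2), (I + J - 1, 3)} :: (nat \<times> nat) set"
  let ?B = "(\<lambda>b. (b, 4 :: nat)) ` {..<I + J}"
  have "card ?A = 4" by simp
  moreover have "card ?B = I + J"
    by (subst card_image) (auto simp: inj_on_def)
  moreover have "card (?A \<union> ?B) = card ?A + card ?B"
    by (rule card_Un_disjoint) auto
  ultimately show ?thesis unfolding fixed_points by simp
qed

section \<open>Cycles of the product and of the commutator along the chain\<close>

text \<open>
  \<open>m\<close>, \<open>l\<close>, \<open>r\<close> list the points whose cycles stay inside a copy, meet its left joint, and meet its right joint.
\<close>

lemma pts_induct:
  assumes p: "p \<in> pts"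
    and cover: "list_all (\<lambda>i. i \<in> set (mP @ lP @ rP)) [0..<57]" "list_all (\<lambda>i. i \<in> set (mQ @ lQ @ rQ)) [0..<49]"
    and mid: "\<And>b i. b < I \<Longrightarrow> i \<in> set mP \<Longrightarrow> R (b, i)"
      "\<And>b i. I \<le> b \<Longrightarrow> b < I + J \<Longrightarrow> i \<in> set mQ \<Longrightarrow> R (b, i)"
    and ends: "\<And>i. i \<in> set lP \<Longrightarrow> R (0, i)"
      "\<And>b i. I \<le> b \<Longrightarrow> Suc b = I + J \<Longrightarrow> i \<in> set rQ \<Longrightarrow> R (b, i)"
    and PP: "\<And>b i. Suc b < I \<Longrightarrow> (i \<in> set rP \<longrightarrow> R (b, i)) \<and> (i \<in> set lP \<longrightarrow> R (Suc b, i))"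
    and PQ: "\<And>b i. b < I \<Longrightarrow> I \<le> Suc b \<Longrightarrow> Suc b < I + J
      \<Longrightarrow> (i \<in> set rP \<longrightarrow> R (b, i)) \<and> (i \<in> set lQ \<longrightarrow> R (Suc b, i))"
    and QQ: "\<And>b i. I \<le> b \<Longrightarrow> Suc b < I + J
      \<Longrightarrow> (i \<in> set rQ \<longrightarrow> R (b, i)) \<and> (i \<in> set lQ \<longrightarrow> R (Suc b, i))"
  shows "R p"
  using p
proof (cases rule: pts_cases)
  case (P b i)
  then consider "i \<in> set mP" | "i \<in> set lP" | "i \<in> set rP" using cover(1) unfolding list_all_upt by auto
  then show ?thesis
  proof cases
    case 2
    then show ?thesis using P ends(1) PP by (cases b) auto
  next
    case 3
    then show ?thesis using P PP PQ J_pos by (cases "Suc b < I") auto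
  qed (use P mid in simp)
next
  case (Q b i)
  then consider "i \<in> set mQ" | "i \<in> set lQ" | "i \<in> set rQ" using cover(2) unfolding list_all_upt by auto
  then show ?thesis
  proof cases
    case 2
    \<comment> \<open>A copy of the second kind always has a predecessor since I > 0. Likewise J > 0
      gives every copy of the first kind a successor, so only \<open>lP\<close> and
      \<open>rQ\<close> occur at open ends.\<close>
    obtain c where "b = Suc c" using Q I_pos by (cases b) auto
    then show ?thesis using 2 Q PQ[of c] QQ[of c] by (cases "c < I") auto
  next
    case 3
    then show ?thesis using Q QQ[of b] ends(2) by (cases "Suc b < I + J") auto
  qed (use Q mid in simp)
qed

text \<open>The lists here and below are complete cycles, sorted by location: inside a copy
  (\<open>P\<close>, \<open>Q\<close>), across a joint (\<open>PP\<close>, \<open>PQ\<close>,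
  \<open>QQ\<close>), at an open end (\<open>L\<close>, \<open>R\<close>). Simplification traces
  each list one step at a time.\<close>

lemma wmap_cycles_P:
  assumes "b < I" "p \<in> set (concat
     [[(b, 4), (b, 10), (b, 37), (b, 49), (b, 55), (b, 43), (b, 13), (b, 20), (b, 21),
       (b, 30), (b, 8), (b, 6), (b, 22), (b, 29), (b, 28), (b, 9), (b, 33), (b, 56),
       (b, 53), (b, 41), (b, 14)]])"
  shows "(wmap ^^ 4232592) p = p"
  by (rule funpow_cycles[OF _ assms(2)])
    (use assms(1) I_pos J_pos in \<open>simp add: wmap_def map_simps table_defs\<close>)

lemma wmap_cycles_Q:
  assumes "I \<le> b" "b < I + J" "p \<in> set (concat
     [[(b, 4), (b, 10), (b, 16), (b, 28), (b, 33), (b, 39), (b, 23), (b, 14), (b, 7), (b, 8),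
       (b, 6), (b, 5), (b, 13), (b, 20), (b, 34), (b, 41), (b, 32), (b, 18), (b, 12)],
      [(b, 9)],
      [(b, 11)]])"
  shows "(wmap ^^ 4232592) p = p"
  by (rule funpow_cycles[OF _ assms(3)])
    (use assms(1-2) I_pos J_pos in \<open>simp add: wmap_def map_simps table_defs\<close>)

lemma wmap_cycles_PP:
  assumes "Suc b < I" "p \<in> set (concat
     [[(b, 3), (Suc b, 45), (Suc b, 17), (Suc b, 23), (Suc b, 36), (Suc b, 51), (b, 47),
       (b, 15), (b, 24), (b, 48), (b, 16), (b, 5), (b, 18), (b, 50), (b, 34), (b, 27),
       (b, 38)],
      [(b, 7), (b, 12), (b, 42), (b, 32), (b, 11), (b, 40), (Suc b, 54), (Suc b, 46),
       (Suc b, 31), (Suc b, 25), (Suc b, 35), (Suc b, 1), (b, 39), (b, 19), (b, 44),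
       (b, 52), (b, 26)],
      [(b, 2)],
      [(Suc b, 0)]])"
  shows "(wmap ^^ 4232592) p = p"
  by (rule funpow_cycles[OF _ assms(2)])
    (use assms(1) I_pos J_pos in \<open>simp add: wmap_def map_simps table_defs\<close>)

lemma wmap_cycles_PQ:
  assumes "b < I" "I \<le> Suc b" "Suc b < I + J" "p \<in> set (concat
     [[(b, 3), (Suc b, 44), (Suc b, 27), (Suc b, 35), (Suc b, 37), (Suc b, 25), (Suc b, 45),
       (b, 47), (b, 15), (b, 24), (b, 48), (b, 16), (b, 5), (b, 18), (b, 50), (b, 34),
       (b, 27), (b, 38)],
      [(b, 7), (b, 12), (b, 42), (b, 32), (b, 11), (b, 40), (Suc b, 47), (Suc b, 29),
       (Suc b, 36), (Suc b, 42), (Suc b, 31), (Suc b, 40), (Suc b, 1), (b, 39), (b, 19),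
       (b, 44), (b, 52), (b, 26)],
      [(b, 2)],
      [(Suc b, 0)]])"
  shows "(wmap ^^ 4232592) p = p"
  by (rule funpow_cycles[OF _ assms(4)])
    (use assms(1-3) I_pos J_pos in \<open>simp add: wmap_def map_simps table_defs\<close>)

lemma wmap_cycles_QQ:
  assumes "I \<le> b" "Suc b < I + J" "p \<in> set (concat
     [[(b, 3), (Suc b, 44), (Suc b, 27), (Suc b, 35), (Suc b, 37), (Suc b, 25), (Suc b, 45),
       (b, 48), (b, 30), (b, 19), (b, 15), (b, 21), (b, 38)],
      [(b, 17), (b, 22), (b, 26), (b, 46), (Suc b, 47), (Suc b, 29), (Suc b, 36), (Suc b, 42),
       (Suc b, 31), (Suc b, 40), (Suc b, 1), (b, 43), (b, 24)],
      [(b, 2)],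
      [(Suc b, 0)]])"
  shows "(wmap ^^ 4232592) p = p"
  by (rule funpow_cycles[OF _ assms(3)])
    (use assms(1-2) I_pos J_pos in \<open>simp add: wmap_def map_simps table_defs\<close>)

lemma wmap_cycles_L:
  assumes "p \<in> set (concat
     [[(0, 0)]])"
  shows "(wmap ^^ 4232592) p = p"
  by (rule funpow_cycles[OF _ assms(1)])
    (use I_pos J_pos in \<open>simp add: wmap_def map_simps table_defs\<close>)

lemma wmap_cycles_R:
  assumes "I \<le> b" "Suc b = I + J" "p \<in> set (concat
     [[(b, 2)],
      [(b, 3), (b, 43), (b, 24), (b, 17), (b, 22), (b, 26), (b, 46), (b, 48), (b, 30),
       (b, 19), (b, 15), (b, 21), (b, 38)]])"
  shows "(wmap ^^ 4232592) p = p"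
  by (rule funpow_cycles[OF _ assms(3)])
    (use assms(1-2) I_pos J_pos in \<open>simp add: wmap_def map_simps table_defs\<close>)

lemma xmap_cycles_P:
  assumes "b < I" "p \<in> set (concat
     [[(b, 4), (b, 7), (b, 13), (b, 25), (b, 24), (b, 12), (b, 6)],
      [(b, 5), (b, 8), (b, 15), (b, 29), (b, 38), (b, 20), (b, 10)],
      [(b, 9), (b, 14), (b, 27), (b, 46), (b, 52), (b, 35), (b, 18)],
      [(b, 11), (b, 16), (b, 31), (b, 37), (b, 19), (b, 28), (b, 22)],
      [(b, 17), (b, 26), (b, 44), (b, 36), (b, 41), (b, 48), (b, 33)],
      [(b, 23), (b, 32), (b, 43), (b, 53), (b, 56), (b, 49), (b, 42)],
      [(b, 55)]])"
  shows "(xmap ^^ 7) p = p"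
  by (rule funpow_cycles[OF _ assms(2)])
    (use assms(1) I_pos J_pos in \<open>simp add: xmap_def map_simps table_defs\<close>)

lemma xmap_cycles_Q:
  assumes "I \<le> b" "b < I + J" "p \<in> set (concat
     [[(b, 4), (b, 7), (b, 11), (b, 10), (b, 5), (b, 8), (b, 6)],
      [(b, 9), (b, 12), (b, 14), (b, 17), (b, 22), (b, 16), (b, 13)],
      [(b, 15), (b, 18), (b, 24), (b, 31), (b, 36), (b, 26), (b, 20)],
      [(b, 19), (b, 23), (b, 29), (b, 41), (b, 40), (b, 28), (b, 21)],
      [(b, 25), (b, 30), (b, 42), (b, 38), (b, 27), (b, 32), (b, 34)]])"
  shows "(xmap ^^ 7) p = p"
  by (rule funpow_cycles[OF _ assms(3)])
    (use assms(1-2) I_pos J_pos in \<open>simp add: xmap_def map_simps table_defs\<close>)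

text \<open>This shows why joining preserves order 7. Open handles lie in 7-cycles (0 1 A) and (2 3
  B) with A and B of five points; the joint turns these into (2 1 A) and (3 B 0), where 0, 1 and A
  belong to the right-hand copy.\<close>

lemma xmap_cycles_PP:
  assumes "Suc b < I" "p \<in> set (concat
     [[(b, 2), (Suc b, 1), (Suc b, 51), (Suc b, 50), (Suc b, 34), (Suc b, 45), (Suc b, 54)],
      [(b, 3), (b, 40), (b, 21), (b, 30), (b, 39), (b, 47), (Suc b, 0)]])"
  shows "(xmap ^^ 7) p = p"
  by (rule funpow_cycles[OF _ assms(2)])
    (use assms(1) I_pos J_pos in \<open>simp add: xmap_def map_simps table_defs\<close>)

lemma xmap_cycles_PQ:
  assumes "b < I" "I \<le> Suc b" "Suc b < I + J" "p \<in> set (concat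
     [[(b, 2), (Suc b, 1), (Suc b, 45), (Suc b, 33), (Suc b, 39), (Suc b, 44), (Suc b, 47)],
      [(b, 3), (b, 40), (b, 21), (b, 30), (b, 39), (b, 47), (Suc b, 0)]])"
  shows "(xmap ^^ 7) p = p"
  by (rule funpow_cycles[OF _ assms(4)])
    (use assms(1-3) I_pos J_pos in \<open>simp add: xmap_def map_simps table_defs\<close>)

lemma xmap_cycles_QQ:
  assumes "I \<le> b" "Suc b < I + J" "p \<in> set (concat
     [[(b, 2), (Suc b, 1), (Suc b, 45), (Suc b, 33), (Suc b, 39), (Suc b, 44), (Suc b, 47)],
      [(b, 3), (b, 46), (b, 35), (b, 37), (b, 43), (b, 48), (Suc b, 0)]])"
  shows "(xmap ^^ 7) p = p"
  by (rule funpow_cycles[OF _ assms(3)])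
    (use assms(1-2) I_pos J_pos in \<open>simp add: xmap_def map_simps table_defs\<close>)

lemma xmap_cycles_L:
  assumes "p \<in> set (concat
     [[(0, 0), (0, 1), (0, 51), (0, 50), (0, 34), (0, 45), (0, 54)]])"
  shows "(xmap ^^ 7) p = p"
  by (rule funpow_cycles[OF _ assms(1)])
    (use I_pos J_pos in \<open>simp add: xmap_def map_simps table_defs\<close>)

lemma xmap_cycles_R:
  assumes "I \<le> b" "Suc b = I + J" "p \<in> set (concat
     [[(b, 2), (b, 3), (b, 46), (b, 35), (b, 37), (b, 43), (b, 48)]])"
  shows "(xmap ^^ 7) p = p"
  by (rule funpow_cycles[OF _ assms(3)])
    (use assms(1-2) I_pos J_pos in \<open>simp add: xmap_def map_simps table_defs\<close>)

text \<open>The 11-cycle of \<open>wmap\<close> at the open left handle. At a joint its points are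
  instead distributed over two longer cycles.\<close>

definition tail :: "(nat \<times> nat) list" where
  "tail = [(0, 1), (0, 45), (0, 17), (0, 23), (0, 36), (0, 51), (0, 54), (0, 46), (0, 31), (0, 25),
     (0, 35)]"

lemma xmap_pow: "(xmap ^^ 7) p = p"
proof (cases "p \<in> pts")
  case True
  then show ?thesis
  proof (rule pts_induct[where R = "\<lambda>p. (xmap ^^ 7) p = p" and
    mP = "[4, 5, 6, 7, 8, 9, 10, 11, 12, 13, 14, 15, 16, 17, 18, 19, 20, 22, 23, 24, 25, 26,
    27, 28, 29, 31, 32, 33, 35, 36, 37, 38, 41, 42, 43, 44, 46, 48, 49, 52, 53, 55, 56]" and lP
    = "[0, 1, 34, 45, 50, 51, 54]" and rP = "[2, 3, 21, 30, 39, 40, 47]" and mQ = "[4, 5, 6, 7,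
    8, 9, 10, 11, 12, 13, 14, 15, 16, 17, 18, 19, 20, 21, 22, 23, 24, 25, 26, 27, 28, 29, 30,
    31, 32, 34, 36, 38, 40, 41, 42]" and lQ = "[0, 1, 33, 39, 44, 45, 47]" and rQ = "[2, 3, 35,
    37, 43, 46, 48]"])
  qed (code_simp, code_simp, (rule xmap_cycles_P, assumption+, auto)[1],
      (rule xmap_cycles_Q, assumption+, auto)[1],
      (rule xmap_cycles_L, auto)[1],
      (rule xmap_cycles_R, assumption+, auto)[1],
      (intro conjI impI; (rule xmap_cycles_PP, assumption+, auto)), (intro conjI impI; (rule xmap_cycles_PQ, assumption+, auto)),
      (intro conjI impI; (rule xmap_cycles_QQ, assumption+, auto)))
next
  case False
  then show ?thesis by (intro funpow_cycles[of "[[p]]"]) (simp_all add: xmap_def map_outside)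
qed

lemma wmap_pow:
  assumes "p \<notin> set tail"
  shows "(wmap ^^ 4232592) p = p"
proof (cases "p \<in> pts")
  case True
  \<comment> \<open>At the open left end \<open>lP\<close> consists of the point 0 and the points of
    \<open>tail\<close>, so the exclusion must be part of the predicate.\<close>
  then have "p \<notin> set tail \<longrightarrow> (wmap ^^ 4232592) p = p"
  proof (rule pts_induct[where R = "\<lambda>p. p \<notin> set tail \<longrightarrow> (wmap ^^ 4232592) p = p" and
    mP = "[4, 6, 8, 9, 10, 13, 14, 20, 21, 22, 28, 29, 30, 33, 37, 41, 43, 49, 53, 55, 56]" and
    lP = "[0, 1, 17, 23, 25, 31, 35, 36, 45, 46, 51, 54]" and rP = "[2, 3, 5, 7, 11, 12, 15,
    16, 18, 19, 24, 26, 27, 32, 34, 38, 39, 40, 42, 44, 47, 48, 50, 52]" and mQ = "[4, 5, 6, 7,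
    8, 9, 10, 11, 12, 13, 14, 16, 18, 20, 23, 28, 32, 33, 34, 39, 41]" and lQ = "[0, 1, 25, 27,
    29, 31, 35, 36, 37, 40, 42, 44, 45, 47]" and rQ = "[2, 3, 15, 17, 19, 21, 22, 24, 26, 30,
    38, 43, 46, 48]"])
  qed (code_simp, code_simp, (intro impI, rule wmap_cycles_P, assumption+, auto)[1], (intro impI, rule wmap_cycles_Q, assumption+, auto)[1],
      (intro impI, rule wmap_cycles_L, auto simp: tail_def)[1], (intro impI, rule wmap_cycles_R, assumption+, auto)[1],
      (intro conjI impI; (rule wmap_cycles_PP, assumption+, auto)), (intro conjI impI; (rule wmap_cycles_PQ, assumption+, auto)),
      (intro conjI impI; (rule wmap_cycles_QQ, assumption+, auto)))
  then show ?thesis using assms by simp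
next
  case False
  then have "wmap p = p" by (simp add: wmap_def map_outside)
  then show ?thesis by (intro funpow_cycles[of "[[p]]"]) simp_all
qed

section \<open>The 11-cycle and the 3-cycle obtained from it\<close>

lemma wmap_tail: "map wmap tail = rotate1 tail"
  using I_pos by (simp add: tail_def wmap_def map_simps table_defs)

text \<open>The least common multiple of 13, 17, 18, 19, 21 is 529074, which is 7 modulo 11. The
  exponent is 8 times this, as 8 inverts 7 modulo 11.\<close>

definition gmap :: "nat \<times> nat \<Rightarrow> nat \<times> nat" where
  "gmap = wmap ^^ 4232592"

lemma gmap_outside: "p \<notin> set tail \<Longrightarrow> gmap p = p"
  unfolding gmap_def by (rule wmap_pow)

lemma gmap_tail: "map gmap tail = rotate1 tail"
proof -
  have "gmap p = wmap p" if "p \<in> set tail" for p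
  proof -
    have "gmap = wmap ^^ Suc 4232591" by (simp add: gmap_def)
    then have "gmap p = wmap ((wmap ^^ 4232591) p)" by (simp only: funpow.simps comp_apply)
    \<comment> \<open>4232591 is a multiple of 11, the length of \<open>tail\<close>.\<close>
    also have "(wmap ^^ 4232591) p = p"
      using wmap_tail that by (intro funpow_cycles[of "[tail]"]) (simp_all add: tail_def)
    finally show ?thesis .
  qed
  then show ?thesis using wmap_tail by (metis map_eq_conv)
qed

lemma gmap_simps:
  "gmap (0, 1) = (0, 45)" "gmap (0, 45) = (0, 17)" "gmap (0, 17) = (0, 23)" "gmap (0, 23) = (0, 36)"
  "gmap (0, 36) = (0, 51)" "gmap (0, 51) = (0, 54)" "gmap (0, 54) = (0, 46)" "gmap (0, 46) = (0, 31)"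
  "gmap (0, 31) = (0, 25)" "gmap (0, 25) = (0, 35)" "gmap (0, 35) = (0, 1)" "gmap (0, 18) = (0, 18)"
  using gmap_tail gmap_outside[of "(0, 18)"] by (simp_all add: tail_def)

lemma tri_diagram_chain:
  assumes "closed_perms H" "ymap \<in> H" "zmap \<in> H"
  shows "closed_perms.tri H (0, 18) (0, 51) (0, 25)" "gmap \<in> H"
proof -
  interpret closed_perms H by fact
  have "wmap \<in> H" unfolding wmap_def by (intro comp_closed assms)
  then show g: "gmap \<in> H"
    using funpow_closed[of wmap 4232591] by (simp add: gmap_def)
  \<comment> \<open>\<open>zmap \<circ> zmap\<close> is the inverse of \<open>zmap\<close>, so h is
    a conjugate of g. It moves exactly the z-image of \<open>tail\<close>, which meets
    \<open>tail\<close> only in the points 51 and 54 of the first copy.\<close>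
  define h where "h = zmap \<circ> gmap \<circ> (zmap \<circ> zmap)"
  have h: "h \<in> H" unfolding h_def by (intro comp_closed assms g)
  define u where "u = gmap \<circ> gmap \<circ> gmap \<circ> gmap"
  have u: "u \<in> H" unfolding u_def by (intro comp_closed g)
  have us: "u (0, 18) = (0, 18)" "u (0, 51) = (0, 25)" "u (0, 54) = (0, 35)" "u (0, 46) = (0, 1)"
    by (simp_all add: u_def gmap_simps gmap_simps[simplified])
  have "tri (0, 18) (0, 51) (u (0, 51))"
  proof (rule tri_of_overlap[OF g h, where b = "(0, 54)" and c = "(0, 46)"])
    fix p assume "gmap p \<noteq> p" "h p \<noteq> p"
    then have "p \<in> set tail" "zmap (zmap p) \<in> set tail"
      using gmap_outside by (metis, metis comp_apply h_def zmap_cube)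
    then show "p = (0, 51) \<or> p = (0, 54)"
      using I_pos by (auto simp: tail_def zmap_P zP_def)
  qed (use u I_pos in \<open>simp_all add: h_def us gmap_simps gmap_simps[simplified] zmap_P zP_def\<close>)
  then show "tri (0, 18) (0, 51) (0, 25)" by (simp add: us)
qed

section \<open>Transitivity on the chain and the 3-cycles of all points\<close>

text \<open>
  The points of a diagram other than the handles are numbered by breadth-first search from the point 4, hence every
  later point has a neighbour with a smaller number.
\<close>

lemma tables_connected:
  assumes z: "\<And>i. i < n \<Longrightarrow> R (zt ! i) \<longleftrightarrow> R i" and y: "\<And>i. 4 \<le> i \<Longrightarrow> i < n \<Longrightarrow> R (yt ! i) \<longleftrightarrow> R i"
    and handles: "list_all (\<lambda>i. zt ! i < n \<and> (zt ! i \<in> set [4..<n] \<or> zt ! (zt ! i) \<in> set [4..<n])) [0..<4]"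
    and search: "list_all (\<lambda>i. zt ! i < n \<and> list_ex (\<lambda>j. 4 \<le> j \<and> j < i) [zt ! i, zt ! (zt ! i), yt ! i]) [5..<n]"
    and i: "4 < n" "i < n"
  shows "R i \<longleftrightarrow> R 4"
proof -
  have main: "4 \<le> i \<Longrightarrow> i < n \<Longrightarrow> R i \<longleftrightarrow> R 4" for i
  proof (induction i rule: less_induct)
    case (less i)
    show ?case
    proof (cases "i = 4")
      case False
      then have "5 \<le> i" using less.prems by simp
      then have zi: "zt ! i < n" and "list_ex (\<lambda>j. 4 \<le> j \<and> j < i) [zt ! i, zt ! (zt ! i), yt ! i]"
        using search less.prems unfolding list_all_upt by blast+
      then obtain j where j: "4 \<le> j" "j < i" "j = zt ! i \<or> j = zt ! (zt ! i) \<or> j = yt ! i"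
        by auto
      then have "j < n" using less.prems by simp
      have "R i \<longleftrightarrow> R j"
        using z[OF less.prems(2)] z[OF zi] y[OF less.prems] j(3) by blast
      also have "\<dots> \<longleftrightarrow> R 4" by (rule less.IH[OF j(2,1) \<open>j < n\<close>])
      finally show ?thesis .
    qed simp
  qed
  show ?thesis
  proof (cases "i < 4")
    case True
    \<comment> \<open>A handle point is reached through z alone, because y may lead from it into
      another copy.\<close>
    then have "zt ! i < n" "zt ! i \<in> set [4..<n] \<or> zt ! (zt ! i) \<in> set [4..<n]"
      using handles unfolding list_all_upt by blast+
    moreover have "R j \<longleftrightarrow> R 4" if "j \<in> set [4..<n]" for j
      using main[of j] that unfolding set_upt by simp
    ultimately show ?thesis using z[OF i(2)] z[of "zt ! i"] by blast
  next
    case False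
    then show ?thesis by (intro main i(2)) simp
  qed
qed

text \<open>Since y and z have finite order, closure of R under them is invariance. Hence R is
  constant on each copy, and y carries it from (b, 2) to the next copy.\<close>

lemma connected:
  assumes y: "\<And>p. R p \<Longrightarrow> R (ymap p)" and z: "\<And>p. R p \<Longrightarrow> R (zmap p)"
    and start: "R (0, k)" "k < 57" and p: "p \<in> pts"
  shows "R p"
proof -
  have ziff: "R (zmap q) \<longleftrightarrow> R q" and yiff: "R (ymap q) \<longleftrightarrow> R q" for q
    using y z by (metis zmap_cube, metis ymap_ymap)
  have blkP: "R (b, i) \<longleftrightarrow> R (b, 4)" if "b < I" "i < 57" for b i
  proof (rule tables_connected[where R = "\<lambda>i. R (b, i)" and n = 57 and zt = zP and yt = yP])
    show "R (b, zP ! j) \<longleftrightarrow> R (b, j)" if "j < 57" for j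
      using ziff[of "(b, j)"] that \<open>b < I\<close> by (simp add: zmap_P)
    show "R (b, yP ! j) \<longleftrightarrow> R (b, j)" if "4 \<le> j" "j < 57" for j
      using yiff[of "(b, j)"] that \<open>b < I\<close> by (simp add: ymap_P)
  qed (code_simp, code_simp, simp, use that in simp)
  have blkQ: "R (b, i) \<longleftrightarrow> R (b, 4)" if "I \<le> b" "b < I + J" "i < 49" for b i
  proof (rule tables_connected[where R = "\<lambda>i. R (b, i)" and n = 49 and zt = zQ and yt = yQ])
    show "R (b, zQ ! j) \<longleftrightarrow> R (b, j)" if "j < 49" for j
      using ziff[of "(b, j)"] that \<open>I \<le> b\<close> \<open>b < I + J\<close> by (simp add: zmap_Q)
    show "R (b, yQ ! j) \<longleftrightarrow> R (b, j)" if "4 \<le> j" "j < 49" for j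
      using yiff[of "(b, j)"] that \<open>I \<le> b\<close> \<open>b < I + J\<close> by (simp add: ymap_Q)
  qed (code_simp, code_simp, simp, use that in simp)
  have blk: "R (b, i) \<longleftrightarrow> R (b, 4)" if "(b, i) \<in> pts" for b i
    using that
  proof (cases rule: pts_cases)
    case (P b' i')
    then show ?thesis using blkP[of b i] by blast
  next
    case (Q b' i')
    then show ?thesis using blkQ[of b i] by blast
  qed
  have "R (b, 4)" if "b < I + J" for b
    using that
  proof (induction b)
    case 0
    then show ?case using start blkP[of 0 k] I_pos by blast
  next
    case (Suc b)
    then have "(b, 2) \<in> pts" "(Suc b, 0) \<in> pts" by (auto simp: pts_def)
    then have "R (b, 2)" using blk[of b 2] Suc by simp
    then have "R (Suc b, 0)" using y[of "(b, 2)"] Suc.prems by (simp add: ymap_R)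
    then show ?case using blk \<open>(Suc b, 0) \<in> pts\<close> by blast
  qed
  moreover have "fst p < I + J" using p by (auto simp: pts_def)
  ultimately show ?thesis using blk[of "fst p" "snd p"] p by (metis prod.collapse)
qed

theorem three_cycles_in:
  assumes H: "closed_perms H" "ymap \<in> H" "zmap \<in> H"
    and p: "p \<in> pts" "q \<in> pts" "r \<in> pts" "distinct [p, q, r]"
  shows "cycle_of_list [p, q, r] \<in> H"
proof -
  interpret closed_perms H by fact
  let ?d = "(0, 18) :: nat \<times> nat"
  note t = tri_diagram_chain(1)[OF H] and g = tri_diagram_chain(2)[OF H]
  define u where "u = gmap \<circ> gmap \<circ> gmap \<circ> gmap"
  have u: "u \<in> H" unfolding u_def by (intro comp_closed g)
  have us: "u (0, 51) = (0, 25)" "u (0, 25) = (0, 17)" "u (0, 17) = (0, 54)" "u (0, 54) = (0, 35)"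
    "u (0, 35) = (0, 23)" "u (0, 23) = (0, 46)" "u (0, 46) = (0, 1)"
    by (simp_all add: u_def gmap_simps gmap_simps[simplified])
  have l: "linked ?d (0, 51)" "linked ?d (0, 25)"
    using t tri_swap[OF t] unfolding linked_def by blast+
  \<comment> \<open>The fourth power of the 11-cycle sends 51 to 25, both in the class, so it
    preserves the class. As 4 is coprime to 11, its iterates sweep out the entire cycle, in
    particular 1 and 54.\<close>
  have step: "linked ?d (u s)" if "linked ?d s" for s
    using linked_invariant[OF u l(1)] l(2) that by (simp add: us)
  have l0: "linked ?d (0, 1)" and l6: "linked ?d (0, 54)"
    using step[OF l(2)] step[of "(0, 17)"] step[of "(0, 54)"] step[of "(0, 35)"] step[of "(0, 23)"]
      step[of "(0, 46)"] by (simp_all add: us)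
  \<comment> \<open>The point 1 of the first copy is fixed by y and sent to 54 by z, so both
    generators preserve the class.\<close>
  have L: "linked ?d s" if "s \<in> pts" for s
  proof (rule connected[where R = "linked ?d", OF _ _ _ _ that])
    show "linked ?d (ymap s)" if "linked ?d s" for s
      using linked_invariant[OF H(2) l0 _ that] l0 by (simp add: ymap_first)
    show "linked ?d (zmap s)" if "linked ?d s" for s
      using linked_invariant[OF H(3) l0 _ that] l6 I_pos by (simp add: zmap_P zP_def)
    show "linked ?d ?d" by (simp add: linked_def)
  qed simp
  have "linked p q" "linked p r"
    by (rule linked_trans[OF linked_sym[OF L] L]; rule p)+
  then have "tri p q r" by (rule tri_of_linked) (use p(4) in auto)
  then show ?thesis by (simp add: tri_def)
qed

end

section \<open>Hurwitz triples and components\<close>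

text \<open>Used to renumber the points of a chain by 1 to n. With a bijection of the whole types,
  conjugation respects composition of arbitrary functions, with no restriction to the finite
  sets.\<close>

lemma bij_extending_finite:
  fixes A :: "'a :: countable set" and B :: "'b :: countable set"
  assumes "infinite (UNIV :: 'a set)" "infinite (UNIV :: 'b set)"
    and "finite A" "finite B" "card A = card B"
  obtains \<sigma> where "bij \<sigma>" "\<sigma> ` A = B"
proof -
  obtain e where e: "bij_betw e A B" using finite_same_card_bij assms by blast
  have inf: "infinite (- A)" "infinite (- B)"
    using assms by (simp_all add: Compl_eq_Diff_UNIV)
  have c: "bij_betw (from_nat_into (- B) \<circ> to_nat_on (- A)) (- A) (- B)"
    by (rule bij_betw_trans[OF to_nat_on_infinite bij_betw_from_nat_into]) (use inf in auto)
  define \<sigma> where "\<sigma> x = (if x \<in> A then e x else (from_nat_into (- B) \<circ> to_nat_on (- A)) x)" for x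
  have \<sigma>A: "bij_betw \<sigma> A B"
    using e by (rule bij_betw_cong[THEN iffD1, rotated]) (simp add: \<sigma>_def)
  have \<sigma>C: "bij_betw \<sigma> (- A) (- B)"
    using c by (rule bij_betw_cong[THEN iffD1, rotated]) (simp add: \<sigma>_def)
  have "bij_betw \<sigma> (A \<union> - A) (B \<union> - B)"
    by (rule bij_betw_combine[OF \<sigma>A \<sigma>C]) auto
  then have "bij \<sigma>" by simp
  then show ?thesis using that \<sigma>A by (simp add: bij_betw_def)
qed

lemma evenperm_of_odd_power:
  assumes "permutation p" "p ^^ k = id" "odd k"
  shows "evenperm p"
proof -
  have "evenperm (p ^^ j) \<longleftrightarrow> even j \<or> evenperm p" for j
  proof (induction j)
    case (Suc j)
    have *: "evenperm (p ^^ Suc j) \<longleftrightarrow> (evenperm p \<longleftrightarrow> evenperm (p ^^ j))"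
      unfolding funpow.simps using assms(1) by (intro evenperm_comp permutation_funpow)
    show ?case unfolding * using Suc by auto
  qed (simp add: evenperm_id)
  from this[of k] show ?thesis using assms by (simp add: evenperm_id)
qed

lemma alt_group_nat_pow: "p [^]\<^bsub>alt_group n\<^esub> (k :: nat) = p ^^ k"
proof (induction k)
  case 0
  then show ?case by (simp add: nat_pow_def alt_group_one)
next
  case (Suc k)
  have "p [^]\<^bsub>alt_group n\<^esub> Suc k = p [^]\<^bsub>alt_group n\<^esub> k \<circ> p" by (simp add: nat_pow_def alt_group_mult)
  also have "\<dots> = p ^^ Suc k" unfolding Suc by (rule funpow_Suc_right[symmetric])
  finally show ?case .
qed

lemma (in group) ord_eq_prime:
  fixes p :: nat
  assumes "x \<in> carrier G" "x [^] p = \<one>" "x \<noteq> \<one>" "Factorial_Ring.prime p"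
  shows "ord x = p"
proof -
  have "ord x dvd p" using assms pow_eq_id by blast
  moreover have "ord x \<noteq> 1" using assms ord_eq_1 by blast
  ultimately show ?thesis using assms(4) by (metis prime_nat_iff)
qed

lemma hurwitz_triple:
  assumes "0 < I" "0 < J"
  defines "n \<equiv> 57 * I + 49 * J"
  obtains x y z where "(x, y, z) \<in> map_triples (alt_group n)"
    "group.ord (alt_group n) x = 7" "group.ord (alt_group n) z = 3" "y \<in> involutions n (I + J + 4)"
proof -
  interpret diagram_chain I J using assms by unfold_locales
  interpret G: group "alt_group n" by (rule alt_group_is_group)
  have cn: "card pts = card {1..n}" by (simp add: card_pts n_def)
  obtain \<sigma> where \<sigma>: "bij \<sigma>" "\<sigma> ` pts = {1..n}"
    using bij_extending_finite[OF _ _ finite_pts _ cn] by (auto simp: finite_prod)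
  define T where "T f = \<sigma> \<circ> f \<circ> inv' \<sigma>" for f
  have i\<sigma>: "inv' \<sigma> (\<sigma> p) = p" "\<sigma> (inv' \<sigma> k) = k" for p k
    using \<sigma>(1) by (simp_all add: bij_is_inj bij_is_surj surj_f_inv_f)
  have \<sigma>_mem: "\<sigma> p \<in> {1..n} \<longleftrightarrow> p \<in> pts" for p
    using \<sigma> by (metis bij_is_inj inj_image_mem_iff)
  have T_apply: "T f (\<sigma> p) = \<sigma> (f p)" for f p by (simp add: T_def i\<sigma>)
  have T_comp: "T (f \<circ> g) = T f \<circ> T g" for f g by (simp add: T_def fun_eq_iff i\<sigma>)
  have T_id: "T id = id" by (simp add: T_def fun_eq_iff i\<sigma>)
  have T_pow: "T (f ^^ k) = T f ^^ k" for f k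
    by (induction k) (simp_all only: funpow.simps T_comp T_id)
  have \<sigma>_eq: "\<sigma> p = \<sigma> q \<longleftrightarrow> p = q" for p q using \<sigma>(1) by (simp add: bij_is_inj inj_eq)
  have T_permutes: "T f permutes {1..n}" if "f permutes pts" for f
  proof -
    have "bij (T f)" unfolding T_def by (intro bij_comp \<sigma> bij_imp_bij_inv permutes_bij[OF that])
    moreover have "T f k = k" if "k \<notin> {1..n}" for k
    proof -
      have "inv' \<sigma> k \<notin> pts" using that \<sigma>_mem[of "inv' \<sigma> k"] i\<sigma>(2)[of k] by argo
      then show ?thesis using \<open>f permutes pts\<close> by (simp add: T_def permutes_not_in i\<sigma>)
    qed
    ultimately show ?thesis by (simp add: permutes_def bij_iff)
  qed
  define y where "y = T ymap"
  define z where "z = T zmap"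
  define v where "v = y \<circ> z"
  have yp: "y permutes {1..n}" and zp: "z permutes {1..n}"
    unfolding y_def z_def by (intro T_permutes ymap_permutes zmap_permutes)+
  have vp: "v permutes {1..n}" unfolding v_def by (intro permutes_compose yp zp)
  have perm: "permutation y" "permutation z" "permutation v"
    using yp zp vp by (auto intro: permutes_imp_permutation)
  have y2: "y \<circ> y = id"
  proof -
    have "ymap \<circ> ymap = id" by (simp add: fun_eq_iff ymap_ymap)
    then show ?thesis unfolding y_def by (metis T_comp T_id)
  qed
  have z3: "z ^^ 3 = id"
  proof -
    have "zmap ^^ 3 = id" by (simp add: fun_eq_iff numeral_3_eq_3 zmap_cube)
    then show ?thesis unfolding z_def by (metis T_pow T_id)
  qed
  have v7: "v ^^ 7 = id"
  proof -
    have "xmap ^^ 7 = id" using xmap_pow by (simp add: fun_eq_iff)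
    moreover have "v = T xmap" by (simp add: v_def y_def z_def xmap_def T_comp)
    ultimately show ?thesis by (metis T_pow T_id)
  qed
  \<comment> \<open>z and v = yz have odd order and so are even; this forces y to be even as
    well.\<close>
  have ev: "evenperm z" "evenperm v"
    using evenperm_of_odd_power[OF perm(2) z3] evenperm_of_odd_power[OF perm(3) v7] by simp_all
  have "evenperm v \<longleftrightarrow> (evenperm y \<longleftrightarrow> evenperm z)"
    unfolding v_def by (intro evenperm_comp perm)
  then have "evenperm y" using ev by simp
  then have c: "y \<in> carrier (alt_group n)" "z \<in> carrier (alt_group n)" "v \<in> carrier (alt_group n)"
    using ev yp zp vp by (simp_all add: alt_group_carrier)
  have nontriv: "T f \<noteq> id" if "f p \<noteq> p" for f p
    using that T_apply[of f p] \<sigma>_eq by (metis id_apply)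
  have "y \<noteq> id" unfolding y_def
    by (rule nontriv[of _ "(0, 5)"]) (use I_pos yP[of 5] in \<open>simp add: ymap_P\<close>)
  moreover have "z \<noteq> id" unfolding z_def
    by (rule nontriv[of _ "(0, 0)"]) (use I_pos in \<open>simp add: zmap_P zP_def\<close>)
  moreover have "v \<noteq> id"
  proof -
    have "v (\<sigma> (0, 4)) = \<sigma> (ymap (zmap (0, 4)))" by (simp add: v_def y_def z_def T_apply)
    also have "\<dots> \<noteq> \<sigma> (0, 4)" using I_pos by (simp add: \<sigma>_eq zmap_P ymap_P zP_def yP_def)
    finally show ?thesis by auto
  qed
  moreover have "y ^^ 2 = id" using y2 by (simp add: numeral_2_eq_2)
  ultimately have o: "G.ord y = 2" "G.ord z = 3" "G.ord v = 7"
    using z3 v7 c G.ord_eq_prime[of _ 2] G.ord_eq_prime[of _ 3] G.ord_eq_prime[of _ 7]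
    unfolding alt_group_nat_pow alt_group_one by simp_all
  define x where "x = inv\<^bsub>alt_group n\<^esub> v"
  have x: "x \<in> carrier (alt_group n)" "G.ord x = 7" using c o by (simp_all add: x_def)
  have yz: "y \<otimes>\<^bsub>alt_group n\<^esub> z = v" by (simp add: alt_group_mult v_def)
  then have xyz: "x \<otimes>\<^bsub>alt_group n\<^esub> y \<otimes>\<^bsub>alt_group n\<^esub> z = \<one>\<^bsub>alt_group n\<^esub>"
    using c x by (simp add: G.m_assoc) (simp add: x_def)
  let ?H = "generate (alt_group n) {x, y, z}"
  have sub: "subgroup ?H (alt_group n)" using c x by (intro G.generate_is_subgroup) simp
  have gens: "y \<in> ?H" "z \<in> ?H" by (auto intro: generate.incl)
  \<comment> \<open>The generated subgroup is pulled back to the points of the chain, where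
    \<open>three_cycles_in\<close> applies.\<close>
  define H where "H = {f. T f \<in> ?H}"
  have H: "closed_perms H"
  proof
    fix f g assume "f \<in> H" "g \<in> H"
    then show "f \<circ> g \<in> H"
      using subgroup.m_closed[OF sub, of "T f" "T g"] by (simp add: H_def T_comp alt_group_mult)
  next
    fix f assume f: "f \<in> H"
    then have Tf: "T f \<in> carrier (alt_group n)" using subgroup.mem_carrier[OF sub] by (simp add: H_def)
    then have bT: "bij (T f)" by (auto simp: alt_group_carrier dest: permutes_bij)
    have "f = inv' \<sigma> \<circ> T f \<circ> \<sigma>" by (simp add: T_def fun_eq_iff i\<sigma>)
    then show b: "bij f" using bT \<sigma>(1) by (metis bij_comp bij_imp_bij_inv)
    have "inv' f \<circ> f = id" using b by (simp add: bij_is_inj fun_eq_iff)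
    then have "T (inv' f) \<circ> T f = id" by (metis T_comp T_id)
    then have "T (inv' f) = inv' (T f)" using bT by (metis bij_is_surj comp_assoc comp_id id_comp surj_iff)
    also have "\<dots> = inv\<^bsub>alt_group n\<^esub> (T f)" by (simp add: alt_group_inv_equality[OF Tf])
    also have "\<dots> \<in> ?H" using f subgroup.m_inv_closed[OF sub] by (simp add: H_def)
    finally show "inv' f \<in> H" by (simp add: H_def)
  qed
  have "three_cycles n \<subseteq> ?H"
  proof
    fix g assume "g \<in> three_cycles n"
    then obtain cs where cs: "g = cycle_of_list cs" "cycle cs" "length cs = 3" "set cs \<subseteq> {1..n}" by auto
    define ps where "ps = map (inv' \<sigma>) cs"
    have m: "map \<sigma> ps = cs" by (simp add: ps_def comp_def i\<sigma>)
    have "length ps = 3" using cs(3) by (simp add: ps_def)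
    then obtain p q r where pqr: "ps = [p, q, r]" using stupid_lemma by blast
    have "distinct [p, q, r]" using cs(2) m pqr by (metis distinct_map)
    moreover have "p \<in> pts" "q \<in> pts" "r \<in> pts"
      using cs(4) m \<sigma>_mem[of p] \<sigma>_mem[of q] \<sigma>_mem[of r] unfolding pqr by force+
    moreover have "ymap \<in> H" "zmap \<in> H" using gens by (simp_all add: H_def y_def z_def)
    ultimately have "cycle_of_list ps \<in> H" and "cycle ps"
      unfolding pqr by (blast intro: three_cycles_in H)+
    moreover have "T (cycle_of_list ps) = cycle_of_list cs"
      unfolding T_def m[symmetric] by (rule conjugation_of_cycle[OF \<open>cycle ps\<close> \<sigma>(1)])
    ultimately show "g \<in> ?H" by (simp add: H_def cs(1))
  qed
  then have "carrier (alt_group n) \<subseteq> ?H"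
    unfolding alt_group_carrier_as_three_cycles by (rule G.generate_subgroup_incl[OF _ sub])
  then have "?H = carrier (alt_group n)" using subgroup.subset[OF sub] by blast
  then have "(x, y, z) \<in> map_triples (alt_group n)"
    using c x o xyz by (simp add: map_triples_def)
  moreover have "{k \<in> {1..n}. y k = k} = \<sigma> ` {p \<in> pts. ymap p = p}"
    unfolding \<sigma>(2)[symmetric] by (auto simp: y_def T_apply \<sigma>_eq)
  then have "card {k \<in> {1..n}. y k = k} = I + J + 4"
    using card_fixed_points \<sigma>(1) by (simp add: card_image bij_is_inj inj_on_def \<sigma>_eq)
  then have "y \<in> involutions n (I + J + 4)" using yp y2 by (simp add: involutions_def)
  ultimately show ?thesis using that x o by blast
qed

section \<open>An invariant of components\<close>

context group
begin

text \<open>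
  Both operations keep \<open>y\<close>, so the size of its conjugacy class is constant on components.
\<close>

definition class_size :: "'a triple \<Rightarrow> nat" where
  "class_size t = card (conj_class G (fst (snd t)))"

text \<open>Automorphisms carry conjugacy classes to conjugacy classes, whence the choice of the
  size as invariant: the automorphisms of the alternating group need not be known.\<close>

lemma class_size_auto:
  assumes "\<phi> \<in> auto G" "t \<in> map_triples G"
  shows "class_size (apply_triple \<phi> t) = class_size t"
proof -
  interpret group_hom G G \<phi> by (rule autoD[OF assms(1)])
  obtain x y z where t: "t = (x, y, z)" by (cases t)
  have y: "y \<in> carrier G" using assms(2) by (simp add: t map_triples_def)
  have b: "bij_betw \<phi> (carrier G) (carrier G)" by (rule autoD[OF assms(1)])
  have "conj_class G (\<phi> y) = (\<lambda>g. g \<otimes> \<phi> y \<otimes> inv g) ` \<phi> ` carrier G"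
    using b by (simp add: conj_class_def bij_betw_def)
  also have "\<dots> = \<phi> ` conj_class G y"
    unfolding conj_class_def image_image using y by (intro image_cong) simp_all
  finally have "conj_class G (\<phi> y) = \<phi> ` conj_class G y" .
  moreover have "conj_class G y \<subseteq> carrier G" using y by (auto simp: conj_class_def)
  then have "inj_on \<phi> (conj_class G y)" using b by (auto simp: bij_betw_def intro: inj_on_subset)
  ultimately show ?thesis by (simp add: class_size_def t card_image)
qed

lemma class_size_orbit:
  assumes "t \<in> map_triples G"
  shows "class_size ` ((\<lambda>\<phi>. apply_triple \<phi> t) ` auto G) = {class_size t}"
  using class_size_auto[OF _ assms] id_in_auto by (auto simp: image_image)

lemma class_size_edge:
  assumes "(M, N) \<in> map_edges G"
  shows "class_size ` N = class_size ` M"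
proof -
  have dual: "class_size (dual_triple G t) = class_size t" for t
    by (cases t) (simp add: class_size_def)
  have hole: "class_size (hole_triple G j t) = class_size t" for j t
    by (cases t) (simp add: class_size_def)
  have "class_size ` dual_map G M = class_size ` M"
    unfolding dual_map_def image_image dual ..
  moreover have "class_size ` hole_map G j M = class_size ` M" for j
    unfolding hole_map_def image_image hole ..
  ultimately show ?thesis using assms unfolding map_edges_def by blast
qed

lemma class_size_connected:
  assumes "(M, N) \<in> map_connected G"
  shows "class_size ` N = class_size ` M"
proof -
  have "(M, N) \<in> (map_edges G \<union> (map_edges G)\<inverse>)\<^sup>*" using assms by (simp add: map_connected_def)
  then show ?thesis
  proof (induction rule: rtrancl_induct)
    case (step N N')
    then have "class_size ` N' = class_size ` N"
      using class_size_edge[of N N'] class_size_edge[of N' N] by blast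
    then show ?case using step.IH by simp
  qed simp
qed

text \<open>Each triple yields a Hurwitz map and thereby a component; the invariant takes different
  values on these components, so they are distinct.\<close>

lemma card_hurwitz_components:
  assumes fin: "finite (carrier G)"
    and t: "\<And>i. i < m \<Longrightarrow> t i \<in> map_triples G"
      "\<And>i. i < m \<Longrightarrow> ord (fst (t i)) = 7" "\<And>i. i < m \<Longrightarrow> ord (snd (snd (t i))) = 3"
    and inj: "inj_on (\<lambda>i. class_size (t i)) {..<m}"
  shows "m \<le> card {C \<in> map_components G. \<exists>M \<in> C. hurwitz_map G M}"
proof -
  define M where "M i = (\<lambda>\<phi>. apply_triple \<phi> (t i)) ` auto G" for i
  define C where "C i = map_connected G `` {M i}" for i
  have M: "M i \<in> regular_maps G" if "i < m" for i
    unfolding M_def by (rule orbit_in_regular_maps[OF t(1)[OF that]])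
  have hur: "hurwitz_map G (M i)" if "i < m" for i
  proof -
    obtain x y z where xyz: "t i = (x, y, z)" by (cases "t i")
    have "x \<in> carrier G" "z \<in> carrier G" using t(1)[OF that] by (simp_all add: xyz map_triples_def)
    then have "has_type G (M i) 3 7"
      using t(2,3)[OF that] ord_auto by (auto simp: has_type_def M_def xyz)
    then show ?thesis using M[OF that] fin by (simp add: hurwitz_map_def)
  qed
  have self: "M i \<in> C i" if "i < m" for i
    unfolding C_def using equiv_class_self[OF equiv_map_connected M[OF that]] .
  have "C ` {..<m} \<subseteq> {C \<in> map_components G. \<exists>M \<in> C. hurwitz_map G M}"
    using M hur self by (auto simp: map_components_def C_def intro!: quotientI)
  then have "card (C ` {..<m}) \<le> card {C \<in> map_components G. \<exists>M \<in> C. hurwitz_map G M}"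
    using finite_map_components[OF fin] by (intro card_mono) auto
  moreover have "inj_on C {..<m}"
  proof (rule inj_onI)
    fix i j assume ij: "i \<in> {..<m}" "j \<in> {..<m}" "C i = C j"
    then have "M i \<in> C j" using self by auto
    then have "class_size ` M i = class_size ` M j"
      using class_size_connected by (simp add: C_def)
    then have "class_size (t i) = class_size (t j)"
      using class_size_orbit t(1) ij by (simp add: M_def)
    then show "i = j" using inj ij by (auto dest: inj_onD)
  qed
  then have "card (C ` {..<m}) = m" by (simp add: card_image)
  ultimately show ?thesis by simp
qed

end

text \<open>The numerical hypotheses fit chains of diagrams, whose degree is at most 57 times the
  number of copies; together they give n \<le> f * f.\<close>

lemma card_involutions_less:
  assumes "involutions n (f + 2 * d) \<noteq> {}" "57 \<le> f" "n \<le> 57 * f" "0 < d"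
  shows "card (involutions n (f + 2 * d)) < card (involutions n f)"
proof -
  have "n \<le> f * f" using assms(2,3) mult_le_mono1[of 57 f f] by linarith
  then have "n < (f + 2) * (f + 1) + f" by (simp add: algebra_simps)
  then show ?thesis using card_involutions_decreasing assms by blast
qed

theorem theorem11p3:
  fixes m :: nat
  shows "\<exists>N :: nat. \<forall>n \<ge> N.
           card {C \<in> map_components (alt_group n). \<exists>M \<in> C. hurwitz_map (alt_group n) M} \<ge> m"
proof (intro exI allI impI)
  fix n :: nat
  \<comment> \<open>As a < 98 below, at least 49 * (57 * m + 1) points remain for the second
    diagram, enough to trade 57 copies of it away in each of fewer than m rounds.\<close>
  assume n: "57 * 98 + 49 * (57 * m + 1) \<le> n"
  let ?G = "alt_group n"
  interpret G: group ?G by (rule alt_group_is_group)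
  \<comment> \<open>43 is the inverse of 57 modulo 49, so 57a is congruent to n. Adding 49 keeps a
    positive and helps to make the number of fixed points at least 57.\<close>
  define a where "a = 43 * n mod 49 + 49"
  have "a < 98" "49 \<le> a" unfolding a_def by simp_all
  have "57 * a mod 49 = (57 * (43 * n mod 49) + 49 * 57) mod 49" by (simp add: a_def distrib_left)
  also have "\<dots> = 57 * (43 * n) mod 49" by (simp only: mod_mult_self2 mod_mult_right_eq)
  also have "57 * (43 * n) = n + 49 * (50 * n)" by simp
  also have "(n + 49 * (50 * n)) mod 49 = n mod 49" by (rule mod_mult_self2)
  finally have "57 * a mod 49 = n mod 49" .
  moreover have "57 * a \<le> n" using n \<open>a < 98\<close> by simp
  ultimately have "49 dvd n - 57 * a" using mod_eq_dvd_iff_nat by metis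
  then obtain b where "n - 57 * a = 49 * b" by (elim dvdE)
  then have nab: "n = 57 * a + 49 * b" using \<open>57 * a \<le> n\<close> by simp
  have b: "57 * m < b" using n nab \<open>a < 98\<close> by simp
  define f where "f i = (a + 49 * i) + (b - 57 * i) + 4" for i
  have f: "f i + 8 * i = a + b + 4" if "i < m" for i using b that by (simp add: f_def)
  have "\<exists>t. t \<in> map_triples ?G \<and> G.ord (fst t) = 7 \<and> G.ord (snd (snd t)) = 3
      \<and> fst (snd t) \<in> involutions n (f i)" if "i < m" for i
  proof -
    have "57 * (a + 49 * i) + 49 * (b - 57 * i) = n" "0 < a + 49 * i" "0 < b - 57 * i"
      using nab b that \<open>49 \<le> a\<close> by (simp_all add: diff_mult_distrib2)
    then show ?thesis using hurwitz_triple[of "a + 49 * i" "b - 57 * i"] by (metis f_def fst_conv snd_conv)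
  qed
  then obtain t where t: "\<And>i. i < m \<Longrightarrow> t i \<in> map_triples ?G" "\<And>i. i < m \<Longrightarrow> G.ord (fst (t i)) = 7"
    "\<And>i. i < m \<Longrightarrow> G.ord (snd (snd (t i))) = 3" "\<And>i. i < m \<Longrightarrow> fst (snd (t i)) \<in> involutions n (f i)"
    by metis
  have size: "G.class_size (t i) = card (involutions n (f i))" if "i < m" for i
  proof -
    have "f i < n" using f[OF that] nab b that \<open>49 \<le> a\<close> by linarith
    then show ?thesis using conj_class_involution[OF t(4)[OF that]] by (simp add: G.class_size_def)
  qed
  have less: "G.class_size (t i) < G.class_size (t j)" if "i < j" "j < m" for i j
  proof -
    have "f i = f j + 2 * (4 * (j - i))"
      using f[of i] f[of j] that by (simp add: diff_mult_distrib2)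
    moreover have "involutions n (f i) \<noteq> {}" using t(4)[of i] that by auto
    \<comment> \<open>From b > 57m and j < m it follows that 8b exceeds 57 * 8j, which absorbs the
      loss of 8j fixed points in n = 57a + 49b.\<close>
    moreover have "57 \<le> f j" "n \<le> 57 * f j"
      using f[OF that(2)] that nab b \<open>49 \<le> a\<close> by linarith+
    ultimately show ?thesis using card_involutions_less[of n "f j" "4 * (j - i)"] that by (simp add: size)
  qed
  have "inj_on (\<lambda>i. G.class_size (t i)) {..<m}"
    by (rule linorder_inj_onI) (use less in \<open>auto simp: less_le\<close>)
  moreover have "finite (carrier ?G)"
    by (rule finite_subset[OF _ finite_permutations[of "{1..n}"]]) (auto simp: alt_group_carrier)
  ultimately show "m \<le> card {C \<in> map_components ?G. \<exists>M \<in> C. hurwitz_map ?G M}"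
    using t by (intro G.card_hurwitz_components) auto
qed

end
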